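(* Let $n\ge 2$, $q>0$, and let $u\in C^{6}(\mathbb{R}^{n})$, $u>0$, solve $\Delta^{3}u=u^{-q}$ in $\mathbb{R}^{n}$ with $u(x)=o(|x|^{4})$ as $|x|\to+\infty$. Then there is a constant $C>0$ such that $\bar u(r)\ge C r^{4/q}$ for all $r\ge 0$ and $\int_{B_{r}(0)}u^{-q}(x)\,dx\le C r^{n-4}$ for all $r>0$. If $n=4$, then $\int_{\mathbb{R}^{4}}u^{-q}\,dx<+\infty$. Consequently, if such a solution exists, then $q\ge 2$ and $n\ge 4$.
   Context: For a function $f$ on $\mathbb{R}^{n}$, $\bar f(r)$ denotes its spherical average over $\partial B_{r}(0)$ ($\bar f(0)=f(0)$).
   Formalization: The two estimates have separate positive constants C (the usual generic-constant reading): a single C for both the lower bound on the average and the upper bound on the integral fails, e.g. for small rescalings of the explicit solution c(1+|x|^2)^{1/2} with n=5, q=11. *)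

theory Defs
  imports "HOL-Analysis.Analysis" "HOL-Library.Landau_Symbols"
begin

definition partial_deriv :: "'n::finite \<Rightarrow> (real^'n \<Rightarrow> real) \<Rightarrow> real^'n \<Rightarrow> real" where
  "partial_deriv i f x = deriv (\<lambda>t. f (x + t *\<^sub>R axis i 1)) 0"

definition has_partials :: "(real^'n::finite \<Rightarrow> real) \<Rightarrow> bool" where
  "has_partials f \<longleftrightarrow> (\<forall>x i. (\<lambda>t. f (x + t *\<^sub>R axis i 1)) differentiable (at 0))"

fun Ck :: "nat \<Rightarrow> (real^'n::finite \<Rightarrow> real) \<Rightarrow> bool" where
  "Ck 0 f = continuous_on UNIV f"
| "Ck (Suc k) f = (continuous_on UNIV f \<and> has_partials f \<and> (\<forall>i. Ck k (partial_deriv i f)))"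

definition laplacian :: "(real^'n::finite \<Rightarrow> real) \<Rightarrow> real^'n \<Rightarrow> real" where
  "laplacian f x = (\<Sum>i\<in>UNIV. partial_deriv i (partial_deriv i f) x)"

text \<open>Spherical average of f over the sphere of radius r centred at 0.
  The normalized surface measure on the unit sphere is the push-forward of the
  normalized Lebesgue measure on the unit ball under x \<mapsto> x/|x|, so
  avg f r = (1/|B_1|) \<integral>_{B_1} f(r x/|x|) dx. For r = 0 this gives f 0.\<close>
definition sph_avg :: "(real^'n::finite \<Rightarrow> real) \<Rightarrow> real \<Rightarrow> real" where
  "sph_avg f r = integral (ball 0 1) (\<lambda>x. f ((r / norm x) *\<^sub>R x)) / measure lebesgue (ball (0::real^'n) 1)"

end

theory Submission
  imports Defs
begin

text \<open>
  Let \<open>U\<^sub>j\<close> be the spherical average of \<open>\<Delta>\<^sup>j u\<close> and \<open>V\<^sub>j(r)\<close> the integral of \<open>\<Delta>\<^sup>j u\<close> over the ball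
  of radius \<open>r\<close>. Polar coordinates and the divergence theorem give
  \<open>V\<^sub>j' = c r\<^bsup>n-1\<^esup> U\<^sub>j\<close> and \<open>U\<^sub>j' = V\<^bsub>j+1\<^esub> / (c r\<^bsup>n-1\<^esup>)\<close>. As \<open>V\<^sub>3 > 0\<close>, \<open>U\<^sub>2\<close> increases; it stays
  negative, since otherwise \<open>U\<^sub>0\<close> would grow like \<open>r\<^sup>4\<close>. Hence \<open>U\<^sub>1\<close> decreases, and it stays
  nonnegative, since otherwise \<open>U\<^sub>0\<close> would become negative. Integrating \<open>U\<^sub>1'\<close> gives
  \<open>- U\<^sub>2(r) \<le> C r\<^bsup>-2\<^esup>\<close>, and integrating \<open>U\<^sub>2'\<close> over \<open>[r, 2r]\<close> then gives \<open>V\<^sub>3(r) \<le> C r\<^bsup>n-4\<^esup>\<close>, which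
  forces \<open>n \<ge> 4\<close>. By Jensen's inequality and monotonicity of \<open>U\<^sub>0\<close>, \<open>V\<^sub>3(r) \<ge> C r\<^sup>n U\<^sub>0(r)\<^bsup>-q\<^esup>\<close>, hence
  the lower bound for \<open>U\<^sub>0\<close>; comparing it with \<open>U\<^sub>0 = O(r\<^sup>2)\<close> gives \<open>q \<ge> 2\<close>.
\<close>

section \<open>Integrals over balls and spherical averages\<close>

lemma has_integral_affinity_UNIV:
  fixes f :: "'a::euclidean_space \<Rightarrow> 'b::banach"
  assumes "(f has_integral I) UNIV" and m: "m > 0" and supp: "\<And>x. x \<notin> cbox a b \<Longrightarrow> f x = 0"
  shows "((\<lambda>x. f (m *\<^sub>R x + c)) has_integral (I /\<^sub>R m ^ DIM('a))) UNIV"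
proof -
  have "(f has_integral I) (cbox a b)"
  proof -
    have "(\<lambda>x. if x \<in> cbox a b then f x else 0) = f" using supp by auto
    then show ?thesis using assms(1) has_integral_restrict_UNIV[of "cbox a b" f I] by simp
  qed
  from has_integral_affinity'[OF this m, of c]
  show ?thesis
  proof (rule has_integral_on_superset)
    fix x assume "x \<notin> cbox ((a - c) /\<^sub>R m) ((b - c) /\<^sub>R m)"
    then have "m *\<^sub>R x + c \<notin> cbox a b"
      using m by (force simp: mem_box inner_simps field_simps)
    then show "f (m *\<^sub>R x + c) = 0" by (rule supp)
  qed simp
qed

lemma integrable_on_bounded_measurable:
  fixes f :: "'a::euclidean_space \<Rightarrow> real"
  assumes "f \<in> borel_measurable borel" "S \<in> lmeasurable" "\<And>x. x \<in> S \<Longrightarrow> \<bar>f x\<bar> \<le> M"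
  shows "f integrable_on S"
proof (rule measurable_bounded_by_integrable_imp_integrable)
  show "f \<in> borel_measurable (lebesgue_on S)"
    using assms(1) by (simp add: borel_measurable_if_D measurable_completion measurable_restrict_space1)
  show "(\<lambda>x. M) integrable_on S" using assms(2) by (rule integrable_on_const)
qed (use assms in \<open>auto simp: fmeasurableD\<close>)

lemma continuous_bounded_cball:
  fixes f :: "'a::euclidean_space \<Rightarrow> real"
  assumes "continuous_on UNIV f"
  obtains M where "M > 0" "\<And>x. norm x \<le> R \<Longrightarrow> \<bar>f x\<bar> \<le> M"
proof -
  have "bounded (f ` cball 0 R)"
    by (intro compact_imp_bounded compact_continuous_image continuous_on_subset[OF assms]) auto
  then show ?thesis using that unfolding bounded_pos by auto
qed

lemma integrable_on_ball_continuous: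
  fixes f :: "'a::euclidean_space \<Rightarrow> real"
  assumes "continuous_on UNIV f"
  shows "f integrable_on ball 0 R"
proof -
  obtain M where "M > 0" "\<And>x. norm x \<le> R \<Longrightarrow> \<bar>f x\<bar> \<le> M"
    using continuous_bounded_cball[OF assms] by blast
  then show ?thesis
    using assms by (intro integrable_on_bounded_measurable[where M=M] borel_measurable_continuous_onI) auto
qed

lemma radial_integrable:
  fixes f :: "'a::euclidean_space \<Rightarrow> real"
  assumes "continuous_on UNIV f" "r \<ge> 0" "S \<in> lmeasurable"
  shows "(\<lambda>x. f ((r / norm x) *\<^sub>R x)) integrable_on S"
proof -
  obtain M where "M > 0" "\<And>x. norm x \<le> r \<Longrightarrow> \<bar>f x\<bar> \<le> M"
    using continuous_bounded_cball[OF assms(1)] by blast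
  moreover have "f \<in> borel_measurable borel" using assms(1) by (rule borel_measurable_continuous_onI)
  ultimately show ?thesis
    using assms by (intro integrable_on_bounded_measurable[where M=M]) auto
qed

lemma measure_ball_pos: "0 < measure lebesgue (ball (0::real^'n) 1)"
  using content_ball_pos[of 1 "0::real^'n"] by simp

lemma measure_ball_scale: "r \<ge> 0 \<Longrightarrow> measure lebesgue (ball (0::real^'n) r) = r ^ CARD('n) * measure lebesgue (ball (0::real^'n) 1)"
  using content_ball_conv_unit_ball[of r "0::real^'n"] by simp

lemma integral_radial_ball:
  fixes f :: "real^'n \<Rightarrow> real"
  assumes f: "continuous_on UNIV f" and r: "r \<ge> 0" and s: "s > 0"
  shows "integral (ball 0 s) (\<lambda>x. f ((r / norm x) *\<^sub>R x))
    = s ^ CARD('n) * integral (ball 0 1) (\<lambda>x. f ((r / norm x) *\<^sub>R x))"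
proof -
  define k where "k x = f ((r / norm x) *\<^sub>R x)" for x
  define g where "g x = (if x \<in> ball 0 s then k x else 0)" for x
  have "(k has_integral integral (ball 0 s) k) (ball 0 s)"
    unfolding k_def by (intro integrable_integral radial_integrable f r) simp
  then have *: "(g has_integral integral (ball 0 s) k) UNIV"
    unfolding g_def by (simp only: has_integral_restrict_UNIV)
  obtain a b where ab: "ball (0::real^'n) s \<subseteq> cbox a b"
    using bounded_subset_cbox_symmetric[OF bounded_ball] by blast
  have "((\<lambda>x. g (s *\<^sub>R x + 0)) has_integral (integral (ball 0 s) k /\<^sub>R s ^ DIM(real^'n))) UNIV"
    by (rule has_integral_affinity_UNIV[OF * s, of a b]) (use ab in \<open>auto simp: g_def\<close>)
  also have "(\<lambda>x. g (s *\<^sub>R x + 0)) = (\<lambda>x. if x \<in> ball 0 1 then k x else 0)"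
    using s by (auto simp: g_def k_def fun_eq_iff)
  finally have "(k has_integral (integral (ball 0 s) k /\<^sub>R s ^ CARD('n))) (ball 0 1)"
    by (simp only: has_integral_restrict_UNIV DIM_cart DIM_real mult_1_right)
  then have "integral (ball 0 1) k = integral (ball 0 s) k /\<^sub>R s ^ CARD('n)" by (rule integral_unique)
  then show ?thesis using s by (simp add: k_def[abs_def] field_simps)
qed

text \<open>By translation invariance the difference quotients of \<open>g\<close> have integral zero.\<close>

lemma integral_partial_eq_0:
  fixes g g' :: "'a::euclidean_space \<Rightarrow> real"
  assumes g: "continuous_on UNIV g" and g': "continuous_on UNIV g'"
    and d: "\<And>x. ((\<lambda>t. g (x + t *\<^sub>R e)) has_real_derivative g' x) (at 0)"
    and supp: "\<And>x. norm x \<ge> R \<Longrightarrow> g x = 0" and e: "norm e = 1"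
  shows "(g' has_integral 0) UNIV"
proof -
  obtain M where M: "M > 0" "\<And>x. norm x \<le> R + 2 \<Longrightarrow> \<bar>g' x\<bar> \<le> M"
    using continuous_bounded_cball[OF g', of "R+2"] by blast
  define t where "t k = inverse (real (Suc k))" for k
  have t: "0 < t k" "t k \<le> 1" for k by (auto simp: t_def field_simps)
  have tl: "t \<longlonglongrightarrow> 0" unfolding t_def by (rule LIMSEQ_inverse_real_of_nat)
  define F where "F k x = (g (x + t k *\<^sub>R e) - g x) / t k" for k x
  obtain a b where ab: "ball (0::'a) R \<subseteq> cbox a b"
    using bounded_subset_cbox_symmetric[OF bounded_ball] by blast
  have gab: "g x = 0" if "x \<notin> cbox a b" for x using that ab supp by (force simp: not_less)
  define I where "I = integral UNIV g"
  have gi: "(g has_integral I) UNIV"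
  proof -
    have "g integrable_on ball 0 R" by (rule integrable_on_ball_continuous[OF g])
    then have "(\<lambda>x. if x \<in> ball 0 R then g x else 0) integrable_on UNIV" by (simp only: integrable_restrict_UNIV)
    moreover have "(\<lambda>x. if x \<in> ball 0 R then g x else 0) = g" using supp by (auto simp: not_less)
    ultimately show ?thesis by (simp add: I_def integrable_integral)
  qed
  have Fi: "(F k has_integral 0) UNIV" for k
  proof -
    have "((\<lambda>x. g (1 *\<^sub>R x + t k *\<^sub>R e)) has_integral (I /\<^sub>R 1 ^ DIM('a))) UNIV"
      by (rule has_integral_affinity_UNIV[OF gi _ gab]) auto
    from has_integral_divide[OF has_integral_diff[OF this gi], of "t k"]
    show ?thesis by (simp add: F_def[abs_def])
  qed
  have line: "((\<lambda>s. g (x + s *\<^sub>R e)) has_real_derivative g' (x + s *\<^sub>R e)) (at s)" for x s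
    using d[of "x + s *\<^sub>R e"] DERIV_shift[of "\<lambda>s. g (x + s *\<^sub>R e)" "g' (x + s *\<^sub>R e)" 0 s]
    by (simp add: algebra_simps)
  have bnd: "norm (F k x) \<le> (if x \<in> cball 0 (R+1) then M else 0)" for k x
  proof (cases "x \<in> cball 0 (R+1)")
    case True
    obtain z where z: "0 < z" "z < t k" "g (x + t k *\<^sub>R e) - g (x + 0 *\<^sub>R e) = (t k - 0) * g' (x + z *\<^sub>R e)"
      using MVT2[OF t(1)[of k], of "\<lambda>s. g (x + s *\<^sub>R e)" "\<lambda>s. g' (x + s *\<^sub>R e)"] line by blast
    have "norm (x + z *\<^sub>R e) \<le> norm x + norm (z *\<^sub>R e)" by (rule norm_triangle_ineq)
    also have "\<dots> \<le> R + 2" using True z t(2)[of k] e by auto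
    finally have "\<bar>g' (x + z *\<^sub>R e)\<bar> \<le> M" by (rule M)
    then show ?thesis using True z t(1)[of k] by (simp add: F_def)
  next
    case False
    have "norm x \<le> norm (x + t k *\<^sub>R e) + norm (t k *\<^sub>R e)"
      by (metis norm_triangle_sub add.commute add_diff_cancel_left' norm_minus_commute)
    then have "norm (x + t k *\<^sub>R e) \<ge> R" using False e t[of k] by auto
    then show ?thesis using False by (simp add: F_def supp)
  qed
  have conv: "(\<lambda>k. F k x) \<longlonglongrightarrow> g' x" for x
  proof -
    have "((\<lambda>h. (g (x + h *\<^sub>R e) - g x) / h) \<longlongrightarrow> g' x) (at 0)"
      using d[of x] by (simp add: DERIV_def)
    moreover have "filterlim t (at 0) sequentially"
      using tl t(1) by (auto simp: filterlim_at intro!: always_eventually less_imp_neq[THEN not_sym])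
    ultimately show ?thesis unfolding F_def using filterlim_compose by blast
  qed
  have hi: "(\<lambda>x. if x \<in> cball 0 (R+1) then M else 0) integrable_on (UNIV::'a set)"
    by (simp only: integrable_restrict_UNIV) (simp add: integrable_on_const)
  have "g' integrable_on UNIV" "(\<lambda>k. integral UNIV (F k)) \<longlonglongrightarrow> integral UNIV g'"
    using dominated_convergence[OF has_integral_integrable[OF Fi] hi bnd conv] by auto
  moreover have "integral UNIV (F k) = 0" for k using Fi by (rule integral_unique)
  ultimately show ?thesis by (simp add: LIMSEQ_const_iff has_integral_iff)
qed

lemma annulus_integral_bound:
  fixes h :: "real^'n \<Rightarrow> real"
  assumes "0 \<le> a" "a \<le> b" and h: "\<And>s. h integrable_on ball 0 s"
    and bnd: "\<And>x. a \<le> norm x \<Longrightarrow> norm x < b \<Longrightarrow> \<bar>h x\<bar> \<le> e"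
  shows "\<bar>integral (ball 0 b) h - integral (ball 0 a) h\<bar>
    \<le> e * (measure lebesgue (ball (0::real^'n) 1) * (b ^ CARD('n) - a ^ CARD('n)))"
proof -
  let ?A = "ball (0::real^'n) b - ball 0 a"
  have sub: "ball (0::real^'n) a - ball 0 b = {}" using assms by auto
  have eq: "integral (ball 0 b) h - integral (ball 0 a) h = integral ?A h"
    using integral_setdiff[of h "ball 0 b" "ball 0 a"] h sub by simp
  have c: "(\<lambda>x::real^'n. e) integrable_on ball 0 s" for s by (simp add: integrable_on_const)
  have ic: "integral (ball (0::real^'n) s) (\<lambda>x. e) = e * measure lebesgue (ball (0::real^'n) s)" for s
    using lmeasure_integral[of "ball (0::real^'n) s"] integral_mult_right[of "ball (0::real^'n) s" e "\<lambda>x. 1"] by simp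
  have eq2: "integral ?A (\<lambda>x. e) = e * (measure lebesgue (ball (0::real^'n) b) - measure lebesgue (ball (0::real^'n) a))"
    using integral_setdiff[of "\<lambda>x::real^'n. e" "ball 0 b" "ball 0 a"] c sub ic by (simp add: right_diff_distrib)
  have "norm (integral ?A h) \<le> integral ?A (\<lambda>x. e)"
  proof (rule integral_norm_bound_integral)
    show "h integrable_on ?A" by (rule integrable_setdiff) (use h sub in auto)
    show "(\<lambda>x. e) integrable_on ?A" by (rule integrable_setdiff) (use c sub in auto)
  qed (use bnd in auto)
  then show ?thesis unfolding eq eq2 using assms
    by (subst (asm) (1 2) measure_ball_scale) (auto simp: algebra_simps)
qed

lemma has_derivative_ball_integral:
  fixes f :: "real^'n \<Rightarrow> real"
  assumes f: "continuous_on UNIV f" and R: "R > 0"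
  shows "((\<lambda>r. integral (ball 0 r) f) has_real_derivative
     real CARD('n) * measure lebesgue (ball (0::real^'n) 1) * R ^ (CARD('n) - 1) * sph_avg f R) (at R)"
proof -
  let ?n = "CARD('n)"
  define B where "B = measure lebesgue (ball (0::real^'n) 1)"
  have B: "B > 0" unfolding B_def by (rule measure_ball_pos)
  define k where "k x = f ((R / norm x) *\<^sub>R x)" for x
  define K where "K = integral (ball 0 1) k"
  define D where "D r = integral (ball 0 r) f - r ^ ?n * K" for r
  have ki: "k integrable_on ball 0 s" for s
    unfolding k_def using f R by (intro radial_integrable) auto
  have fi: "f integrable_on ball 0 s" for s by (rule integrable_on_ball_continuous[OF f])
  have hi: "(\<lambda>x. f x - k x) integrable_on ball 0 s" for s by (intro integrable_diff fi ki)
  have D_eq: "D r = integral (ball 0 r) (\<lambda>x. f x - k x)" if "r > 0" for r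
  proof -
    have "integral (ball 0 r) k = r ^ ?n * K"
      unfolding k_def K_def using f R that by (intro integral_radial_ball) auto
    then show ?thesis using integral_diff[OF fi[of r] ki[of r]] by (simp add: D_def)
  qed
  define Q where "Q = B * (real ?n * R ^ (?n - 1)) + 1"
  have Q: "Q > 0" using B R by (auto simp: Q_def intro!: add_nonneg_pos)
  have pw: "((\<lambda>y. (y ^ ?n - R ^ ?n) / (y - R)) \<longlongrightarrow> real ?n * R ^ (?n - 1)) (at R)"
    using DERIV_power[OF DERIV_ident, of ?n R UNIV] by (simp add: has_field_derivative_iff mult.commute)
  have "((\<lambda>y. (D y - D R) / (y - R)) \<longlongrightarrow> 0) (at R)"
  proof (rule tendstoI)
    fix e :: real assume e: "e > 0"
    have uc: "uniformly_continuous_on (cball 0 (2*R)) f"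
      using f by (intro compact_uniformly_continuous) (auto intro: continuous_on_subset)
    have eQ: "e / Q > 0" using e Q by simp
    obtain d where d: "d > 0"
      "\<And>x y. x \<in> cball 0 (2*R) \<Longrightarrow> y \<in> cball 0 (2*R) \<Longrightarrow> dist y x < d \<Longrightarrow> dist (f y) (f x) < e / Q"
      using uniformly_continuous_onE[OF uc eQ] by metis
    have key: "\<bar>D b - D a\<bar> \<le> e / Q * (B * (b ^ ?n - a ^ ?n))"
      if "0 < a" "a \<le> R" "R \<le> b" "b \<le> 2 * R" "R - a < d" "b - R < d" for a b
    proof -
      have "\<bar>f x - k x\<bar> \<le> e / Q" if x: "a \<le> norm x" "norm x < b" for x
      proof -
        have nx: "norm x > 0" using x \<open>0 < a\<close> by linarith
        have "x - (R / norm x) *\<^sub>R x = (1 - R / norm x) *\<^sub>R x" by (simp add: algebra_simps)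
        then have "norm (x - (R / norm x) *\<^sub>R x) = \<bar>1 - R / norm x\<bar> * norm x" by simp
        also have "\<dots> = \<bar>(1 - R / norm x) * norm x\<bar>" by (simp add: abs_mult)
        also have "(1 - R / norm x) * norm x = norm x - R" using nx by (simp add: algebra_simps)
        also have "\<bar>norm x - R\<bar> < d" using x \<open>R - a < d\<close> \<open>b - R < d\<close> by linarith
        finally have "dist (f x) (f ((R / norm x) *\<^sub>R x)) < e / Q"
          using x nx \<open>b \<le> 2 * R\<close> R by (intro d(2)) (auto simp: dist_norm)
        then show ?thesis by (simp add: k_def dist_real_def)
      qed
      then show ?thesis
        using annulus_integral_bound[of a b "\<lambda>x. f x - k x" "e / Q"] that hi R
        by (simp add: D_eq B_def)
    qed
    have mono: "(b ^ ?n - a ^ ?n) \<ge> 0" if "0 < a" "a \<le> b" for a b :: real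
      using that by (simp add: power_mono)
    have ev1: "\<forall>\<^sub>F y in at R. B * ((y ^ ?n - R ^ ?n) / (y - R)) < Q"
      using tendsto_mult_left[OF pw, of B] by (rule order_tendstoD) (simp add: Q_def)
    have ev2: "\<forall>\<^sub>F y in at R. dist y R < min d (R/2)"
      using d(1) R by (auto simp: eventually_at intro!: exI[of _ "min d (R/2)"])
    have ev3: "\<forall>\<^sub>F y in at R. y \<noteq> R" by (simp add: eventually_neq_at_within)
    show "\<forall>\<^sub>F y in at R. dist ((D y - D R) / (y - R)) 0 < e"
      using ev1 ev2 ev3
    proof eventually_elim
      case (elim y)
      have y: "y > 0" "y \<le> 2 * R" "\<bar>y - R\<bar> < d"
        using elim(2) R unfolding dist_real_def min_less_iff_conj by linarith+
      have "\<bar>D y - D R\<bar> \<le> e / Q * (B * \<bar>y ^ ?n - R ^ ?n\<bar>)"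
      proof (cases "y \<ge> R")
        case True
        then show ?thesis using key[of R y] y R d(1) mono[of R y] by simp
      next
        case False
        then show ?thesis using key[of y R] y R d(1) mono[of y R] by (simp add: abs_minus_commute)
      qed
      then have "\<bar>(D y - D R) / (y - R)\<bar> \<le> e / Q * (B * \<bar>(y ^ ?n - R ^ ?n) / (y - R)\<bar>)"
        using elim(3) by (simp add: abs_divide field_simps)
      also have "\<bar>(y ^ ?n - R ^ ?n) / (y - R)\<bar> = (y ^ ?n - R ^ ?n) / (y - R)"
      proof (cases "y \<ge> R")
        case True
        then show ?thesis using mono[of R y] R by simp
      next
        case False
        then have "(y ^ ?n - R ^ ?n) \<le> 0" using mono[of y R] y by simp
        then show ?thesis using False by (intro abs_of_nonneg divide_nonpos_nonpos) auto
      qed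
      also have "e / Q * (B * ((y ^ ?n - R ^ ?n) / (y - R))) < e / Q * Q"
        using elim(1) e Q by (intro mult_strict_left_mono) auto
      finally show ?case using Q by simp
    qed
  qed
  then have "(D has_real_derivative 0) (at R)" by (simp add: has_field_derivative_iff)
  from DERIV_add[OF this DERIV_cmult[OF DERIV_power[OF DERIV_ident, of ?n R UNIV], of K]]
  have "((\<lambda>r. D r + K * r ^ ?n) has_real_derivative K * (real ?n * R ^ (?n - 1))) (at R)"
    by (simp add: ac_simps)
  moreover have "K = B * sph_avg f R" using B by (simp add: sph_avg_def K_def k_def[abs_def] B_def)
  ultimately show ?thesis by (simp add: D_def B_def ac_simps)
qed

lemma has_derivative_sph_avg:
  fixes f G :: "real^'n \<Rightarrow> real"
  assumes f: "continuous_on UNIV f" and G: "continuous_on UNIV G" and r: "r > 0"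
    and d: "\<And>w s. s > 0 \<Longrightarrow> ((\<lambda>s. f (s *\<^sub>R w)) has_real_derivative G (s *\<^sub>R w) / s) (at s)"
  shows "(sph_avg f has_real_derivative sph_avg G r / r) (at r)"
proof -
  define B where "B = measure lebesgue (ball (0::real^'n) 1)"
  have B: "B > 0" unfolding B_def by (rule measure_ball_pos)
  define S where "S = {r/2<..<2*r}"
  obtain M where M: "M > 0" "\<And>x. norm x \<le> 2*r \<Longrightarrow> \<bar>G x\<bar> \<le> M"
    using continuous_bounded_cball[OF G] by blast
  have "((\<lambda>y. (sph_avg f y - sph_avg f r) / (y - r)) \<longlongrightarrow> sph_avg G r / r) (at r within S)"
    unfolding tendsto_at_iff_sequentially
  proof (intro allI impI)
    fix X assume X: "\<forall>i. X i \<in> S - {r}" "X \<longlonglongrightarrow> r"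
    define w where "w x = x /\<^sub>R norm x" for x :: "real^'n"
    have w: "norm (w x) \<le> 1" for x by (cases "x = 0") (auto simp: w_def)
    have wr: "(s / norm x) *\<^sub>R x = s *\<^sub>R w x" for s x by (simp add: w_def divide_inverse)
    define F where "F k x = (f (X k *\<^sub>R w x) - f (r *\<^sub>R w x)) / (X k - r)" for k x
    have Xk: "X k \<noteq> r" "X k > r/2" "X k < 2*r" for k using X(1) by (auto simp: S_def)
    have int: "(\<lambda>x. f (s *\<^sub>R w x)) integrable_on ball 0 1" if "s \<ge> 0" for s
      using radial_integrable[OF f that, of "ball 0 1"] by (simp add: wr)
    have ii: "integral (ball 0 1) (\<lambda>x. f (s *\<^sub>R w x)) = B * sph_avg f s" for s
      using B by (simp add: sph_avg_def wr B_def)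
    have Fi: "(F k has_integral (B * sph_avg f (X k) - B * sph_avg f r) / (X k - r)) (ball 0 1)" for k
      unfolding F_def[abs_def]
      by (intro has_integral_divide has_integral_diff) (use int[of "X k"] int[of r] Xk[of k] r ii in \<open>auto simp: has_integral_iff\<close>)
    have bnd: "norm (F k x) \<le> M / (r/2)" for k x
    proof -
      have mvt: "\<exists>z. a < z \<and> z < b \<and> f (b *\<^sub>R w x) - f (a *\<^sub>R w x) = (b - a) * (G (z *\<^sub>R w x) / z)"
        if "0 < a" "a < b" for a b
        using that by (intro MVT2 d) auto
      obtain z where z: "z > r/2" "z < 2*r" "F k x = G (z *\<^sub>R w x) / z"
      proof (cases "X k < r")
        case True
        obtain z where "X k < z" "z < r" "f (r *\<^sub>R w x) - f (X k *\<^sub>R w x) = (r - X k) * (G (z *\<^sub>R w x) / z)"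
          using mvt[of "X k" r] True Xk[of k] r by auto
        moreover have "F k x = (f (r *\<^sub>R w x) - f (X k *\<^sub>R w x)) / (r - X k)"
          unfolding F_def by (metis minus_diff_eq minus_divide_divide)
        ultimately show ?thesis using True Xk[of k] r that[of z] by auto
      next
        case False
        then obtain z where "r < z" "z < X k" "f (X k *\<^sub>R w x) - f (r *\<^sub>R w x) = (X k - r) * (G (z *\<^sub>R w x) / z)"
          using mvt[of r "X k"] Xk[of k] r by auto
        then show ?thesis using Xk[of k] r that[of z] by (auto simp: F_def)
      qed
      have "norm (z *\<^sub>R w x) \<le> z * 1" using z r w[of x] by (auto intro!: mult_left_mono)
      then have "\<bar>G (z *\<^sub>R w x)\<bar> \<le> M" using z by (intro M) linarith
      then have "\<bar>G (z *\<^sub>R w x)\<bar> / z \<le> M / (r/2)" using z r M(1) by (intro frac_le) auto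
      then show ?thesis using z r by (simp add: abs_divide)
    qed
    have conv: "(\<lambda>k. F k x) \<longlonglongrightarrow> G (r *\<^sub>R w x) / r" for x
    proof -
      have "((\<lambda>y. (f (y *\<^sub>R w x) - f (r *\<^sub>R w x)) / (y - r)) \<longlongrightarrow> G (r *\<^sub>R w x) / r) (at r)"
        using d[OF r, of "w x"] by (simp add: has_field_derivative_iff)
      moreover have "filterlim X (at r) sequentially"
        using X Xk by (auto simp: filterlim_at)
      ultimately show ?thesis unfolding F_def using filterlim_compose by blast
    qed
    have "(\<lambda>k. integral (ball 0 1) (F k)) \<longlonglongrightarrow> integral (ball 0 1) (\<lambda>x. G (r *\<^sub>R w x) / r)"
      by (rule dominated_convergence(2)[where h="\<lambda>x. M / (r/2)"])
        (use Fi bnd conv in \<open>auto intro: integrable_on_const\<close>)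
    moreover have "integral (ball 0 1) (F k) = B * ((sph_avg f (X k) - sph_avg f r) / (X k - r))" for k
      using integral_unique[OF Fi[of k]] by (simp add: right_diff_distrib)
    moreover have "integral (ball 0 1) (\<lambda>x. G (r *\<^sub>R w x) / r) = B * (sph_avg G r / r)"
      using B by (simp add: sph_avg_def wr B_def)
    ultimately have "(\<lambda>k. B * ((sph_avg f (X k) - sph_avg f r) / (X k - r))) \<longlonglongrightarrow> B * (sph_avg G r / r)"
      by (simp only:)
    from tendsto_mult_left[OF this, of "1/B"] B
    show "((\<lambda>y. (sph_avg f y - sph_avg f r) / (y - r)) \<circ> X) \<longlonglongrightarrow> sph_avg G r / r"
      by (simp add: o_def)
  qed
  moreover have "at r within S = at r" using r by (intro at_within_open) (auto simp: S_def)
  ultimately show ?thesis by (simp add: has_field_derivative_iff)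
qed

section \<open>Calculus of \<open>C\<^sup>k\<close> functions\<close>

lemma Ck_continuous: "Ck k f \<Longrightarrow> continuous_on UNIV f"
  by (cases k) auto

lemma Ck_has_partials: "Ck (Suc k) f \<Longrightarrow> has_partials f"
  by simp

lemma Ck_partial_deriv: "Ck (Suc k) f \<Longrightarrow> Ck k (partial_deriv i f)"
  by simp

lemma Ck_Suc_imp: "Ck (Suc k) f \<Longrightarrow> Ck k f"
proof (induction k arbitrary: f)
  case (Suc k)
  then show ?case by (metis Ck.simps(2))
qed simp

lemma Ck_antimono: "k \<le> l \<Longrightarrow> Ck l f \<Longrightarrow> Ck k f"
  by (induction rule: inc_induct) (auto intro: Ck_Suc_imp simp del: Ck.simps)

lemma has_partials_has_derivative:
  assumes "has_partials f"
  shows "((\<lambda>t. f (x + t *\<^sub>R axis i 1)) has_real_derivative partial_deriv i f x) (at 0)"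
  using assms unfolding has_partials_def partial_deriv_def
  by (simp add: DERIV_deriv_iff_real_differentiable)

lemma has_partials_sum:
  assumes "finite A" "\<And>a. a \<in> A \<Longrightarrow> has_partials (f a)"
  shows "has_partials (\<lambda>x. \<Sum>a\<in>A. f a x)"
    and "partial_deriv i (\<lambda>x. \<Sum>a\<in>A. f a x) = (\<lambda>x. \<Sum>a\<in>A. partial_deriv i (f a) x)"
proof -
  have *: "((\<lambda>t. \<Sum>a\<in>A. f a (x + t *\<^sub>R axis i 1)) has_real_derivative (\<Sum>a\<in>A. partial_deriv i (f a) x)) (at 0)" for x i
    using assms by (intro DERIV_sum has_partials_has_derivative) auto
  show "has_partials (\<lambda>x. \<Sum>a\<in>A. f a x)"
    unfolding has_partials_def using * real_differentiable_def by blast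
  show "partial_deriv i (\<lambda>x. \<Sum>a\<in>A. f a x) = (\<lambda>x. \<Sum>a\<in>A. partial_deriv i (f a) x)"
    unfolding partial_deriv_def[of i "\<lambda>x. \<Sum>a\<in>A. f a x"] using * by (intro ext DERIV_imp_deriv) auto
qed

lemma Ck_sum:
  assumes "finite A" "\<And>a. a \<in> A \<Longrightarrow> Ck k (f a)"
  shows "Ck k (\<lambda>x. \<Sum>a\<in>A. f a x)"
  using assms
proof (induction k arbitrary: f)
  case 0
  then show ?case by (auto intro!: continuous_on_sum)
next
  case (Suc k)
  then show ?case by (auto intro!: continuous_on_sum has_partials_sum(1) simp: has_partials_sum(2))
qed

lemma Ck_laplacian: "Ck (Suc (Suc k)) f \<Longrightarrow> Ck k (laplacian f)"
  unfolding laplacian_def[abs_def] by (intro Ck_sum) auto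

lemma has_partials_line:
  assumes "has_partials f"
  shows "((\<lambda>t. f (x + t *\<^sub>R axis i 1)) has_real_derivative partial_deriv i f (x + s *\<^sub>R axis i 1)) (at s)"
  using has_partials_has_derivative[OF assms, of "x + s *\<^sub>R axis i 1" i]
    DERIV_shift[of "\<lambda>s. f (x + s *\<^sub>R axis i 1)" "partial_deriv i f (x + s *\<^sub>R axis i 1)" 0 s]
  by (simp add: algebra_simps)

lemma C1_increment_bound:
  fixes f :: "real^'n \<Rightarrow> real"
  assumes f: "has_partials f" and A: "finite A"
    and near: "\<And>y i. norm (y - x) \<le> norm h \<Longrightarrow> \<bar>partial_deriv i f y - partial_deriv i f x\<bar> \<le> e"
  shows "\<bar>f (x + (\<Sum>i\<in>A. (h$i) *\<^sub>R axis i 1)) - f x - (\<Sum>i\<in>A. partial_deriv i f x * h$i)\<bar> \<le> real (card A) * e * norm h"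
  using A
proof (induction A)
  case empty
  then show ?case by simp
next
  case (insert j A)
  define y where "y = x + (\<Sum>i\<in>A. (h$i) *\<^sub>R axis i 1)"
  have comp: "(\<Sum>i\<in>A. (h$i) *\<^sub>R axis i (1::real)) $ l = (if l \<in> A then h$l else 0)" for l
    using insert(1) by (simp add: axis_def if_distrib[of "\<lambda>x. _ * x"] cong: if_cong)
  have seg: "norm (y + t *\<^sub>R axis j 1 - x) \<le> norm h" if "\<bar>t\<bar> \<le> \<bar>h$j\<bar>" for t
  proof (rule norm_le_componentwise_cart)
    fix l
    have "(y + t *\<^sub>R axis j 1 - x) $ l = (if l \<in> A then h$l else 0) + (if l = j then t else 0)"
      by (simp add: y_def comp[simplified]) (simp add: axis_def)
    then show "norm ((y + t *\<^sub>R axis j 1 - x) $ l) \<le> norm (h $ l)"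
      using that insert(2) by auto
  qed
  have step: "\<bar>f (y + (h$j) *\<^sub>R axis j 1) - f y - h$j * partial_deriv j f x\<bar> \<le> e * \<bar>h$j\<bar>"
  proof -
    let ?g = "\<lambda>t. f (y + t *\<^sub>R axis j 1) - t * partial_deriv j f x"
    have "\<bar>?g (h$j) - ?g 0\<bar> \<le> e * \<bar>h$j - 0\<bar>"
    proof (rule field_differentiable_bound[where S="{- \<bar>h$j\<bar>..\<bar>h$j\<bar>}" and f'="\<lambda>t. partial_deriv j f (y + t *\<^sub>R axis j 1) - partial_deriv j f x", simplified real_norm_def])
      show "(?g has_real_derivative partial_deriv j f (y + t *\<^sub>R axis j 1) - partial_deriv j f x) (at t within {- \<bar>h$j\<bar>..\<bar>h$j\<bar>})" for t
        by (rule has_field_derivative_at_within) (auto intro!: derivative_eq_intros has_partials_line[OF f])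
      show "\<bar>partial_deriv j f (y + t *\<^sub>R axis j 1) - partial_deriv j f x\<bar> \<le> e" if "t \<in> {- \<bar>h$j\<bar>..\<bar>h$j\<bar>}" for t
        using that by (intro near seg) auto
    qed auto
    then show ?thesis by (simp add: algebra_simps)
  qed
  have e0: "e \<ge> 0" using near[of x undefined] by simp
  have "e * \<bar>h$j\<bar> \<le> e * norm h" using e0 by (intro mult_left_mono component_le_norm_cart) auto
  with step insert.IH insert.hyps show ?case
    by (simp add: y_def algebra_simps)
qed

lemma C1_has_derivative:
  fixes f :: "real^'n \<Rightarrow> real"
  assumes "Ck 1 f"
  shows "(f has_derivative (\<lambda>h. \<Sum>i\<in>UNIV. partial_deriv i f x * h$i)) (at x)"
  unfolding has_derivative_at_alt
proof (intro conjI allI impI)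
  show "bounded_linear (\<lambda>h. \<Sum>i\<in>UNIV. partial_deriv i f x * h$i)"
    by (intro bounded_linear_sum bounded_linear_const_mult bounded_linear_vec_nth)
  fix e :: real assume e: "e > 0"
  have hp: "has_partials f" and cont: "\<And>i. continuous_on UNIV (partial_deriv i f)"
    using assms by (auto simp: numeral_eq_Suc)
  define e' where "e' = e / real CARD('n)"
  have e': "e' > 0" using e by (simp add: e'_def)
  have "\<exists>d>0. \<forall>y. norm (y - x) < d \<longrightarrow> \<bar>partial_deriv i f y - partial_deriv i f x\<bar> < e'" for i
    using cont[of i] e' unfolding continuous_on_iff by (simp add: dist_norm)
  then obtain d where d: "\<And>i. d i > 0"
    "\<And>i y. norm (y - x) < d i \<Longrightarrow> \<bar>partial_deriv i f y - partial_deriv i f x\<bar> < e'" by metis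
  define D where "D = Min (range d)"
  have D: "D > 0" "\<And>i. D \<le> d i" unfolding D_def using d(1) by auto
  show "\<exists>d>0. \<forall>y. norm (y - x) < d \<longrightarrow>
      norm (f y - f x - (\<Sum>i\<in>UNIV. partial_deriv i f x * (y - x) $ i)) \<le> e * norm (y - x)"
  proof (intro exI[of _ D] conjI D allI impI)
    fix y assume y: "norm (y - x) < D"
    have "\<bar>f (x + (\<Sum>i\<in>UNIV. ((y - x)$i) *\<^sub>R axis i 1)) - f x - (\<Sum>i\<in>UNIV. partial_deriv i f x * (y - x)$i)\<bar>
        \<le> real (card (UNIV :: 'n set)) * e' * norm (y - x)"
    proof (rule C1_increment_bound[OF hp])
      fix z i assume "norm (z - x) \<le> norm (y - x)"
      then have "norm (z - x) < d i" using y D(2)[of i] by linarith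
      then show "\<bar>partial_deriv i f z - partial_deriv i f x\<bar> \<le> e'" using d(2) less_imp_le by blast
    qed simp
    moreover have "(\<Sum>i\<in>UNIV. ((y - x)$i) *\<^sub>R axis i 1) = y - x"
      using basis_expansion[of "y - x"] by (simp add: scalar_mult_eq_scaleR)
    ultimately show "norm (f y - f x - (\<Sum>i\<in>UNIV. partial_deriv i f x * (y - x) $ i)) \<le> e * norm (y - x)"
      by (simp add: e'_def)
  qed
qed

definition euler_deriv :: "(real^'n \<Rightarrow> real) \<Rightarrow> real^'n \<Rightarrow> real" where
  "euler_deriv f x = (\<Sum>i\<in>UNIV. partial_deriv i f x * x$i)"

lemma continuous_euler_deriv: "Ck 1 f \<Longrightarrow> continuous_on UNIV (euler_deriv f)"
  unfolding euler_deriv_def[abs_def] by (intro continuous_intros) (auto simp: numeral_eq_Suc)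

lemma ray_has_derivative:
  assumes "Ck 1 f" "s > 0"
  shows "((\<lambda>s. f (s *\<^sub>R w)) has_real_derivative euler_deriv f (s *\<^sub>R w) / s) (at s)"
proof -
  have "((\<lambda>s. s *\<^sub>R w) has_derivative (\<lambda>t. t *\<^sub>R w)) (at s)"
    by (auto intro!: derivative_eq_intros)
  from has_derivative_compose[OF this C1_has_derivative[OF assms(1)]]
  have "((\<lambda>s. f (s *\<^sub>R w)) has_derivative (\<lambda>t. \<Sum>i\<in>UNIV. partial_deriv i f (s *\<^sub>R w) * (t *\<^sub>R w)$i)) (at s)" .
  moreover have "(\<lambda>t. \<Sum>i\<in>UNIV. partial_deriv i f (s *\<^sub>R w) * (t *\<^sub>R w)$i) = (*) (euler_deriv f (s *\<^sub>R w) / s)"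
    using assms(2) by (auto simp: fun_eq_iff euler_deriv_def sum_divide_distrib sum_distrib_right sum_distrib_left field_simps)
  ultimately show ?thesis by (simp add: has_field_derivative_def)
qed

lemma max0_square_has_derivative:
  "((\<lambda>y::real. (max 0 y)\<^sup>2) has_real_derivative 2 * max 0 y) (at y)"
proof -
  consider "y > 0" | "y < 0" | "y = 0" by linarith
  then show ?thesis
  proof cases
    case 1
    have "((\<lambda>y. y\<^sup>2) has_real_derivative 2 * max 0 y) (at y)"
      using 1 by (auto intro!: derivative_eq_intros)
    then show ?thesis
      by (rule DERIV_cong_ev[OF refl _ refl, THEN iffD1, rotated])
        (use 1 in \<open>auto simp: eventually_nhds intro!: exI[of _ "{0<..}"]\<close>)
  next
    case 2
    have "((\<lambda>y. 0) has_real_derivative 2 * max 0 y) (at y)"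
      using 2 by (auto intro!: derivative_eq_intros)
    then show ?thesis
      by (rule DERIV_cong_ev[OF refl _ refl, THEN iffD1, rotated])
        (use 2 in \<open>auto simp: eventually_nhds intro!: exI[of _ "{..<0}"]\<close>)
  next
    case 3
    have "((\<lambda>h::real. (max 0 h)\<^sup>2 / h) \<longlongrightarrow> 0) (at 0)"
    proof (rule Lim_null_comparison)
      show "\<forall>\<^sub>F h in at (0::real). norm ((max 0 h)\<^sup>2 / h) \<le> \<bar>h\<bar>"
        by (rule always_eventually) (auto simp: max_def power2_eq_square)
    qed (auto intro!: tendsto_eq_intros)
    then show ?thesis using 3 by (simp add: DERIV_def)
  qed
qed

lemma weighted_green_identity:
  fixes f :: "real^'n \<Rightarrow> real"
  assumes f: "Ck 2 f" and R: "R > 0"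
  shows "integral (ball 0 R) (\<lambda>x. (R\<^sup>2 - (norm x)\<^sup>2)\<^sup>2 * laplacian f x)
    = integral (ball 0 R) (\<lambda>x. 4 * (R\<^sup>2 - (norm x)\<^sup>2) * euler_deriv f x)"
proof -
  define m where "m x = max 0 (R\<^sup>2 - (norm x)\<^sup>2)" for x :: "real^'n"
  have f1: "Ck 1 (partial_deriv i f)" "has_partials f" for i
    using f Ck_partial_deriv[of 1 f i] Ck_has_partials[of 1 f] by (auto simp: numeral_2_eq_2 simp del: Ck.simps)
  have cf: "continuous_on UNIV (partial_deriv i f)" "continuous_on UNIV (partial_deriv i (partial_deriv i f))" for i
    using f1(1)[of i] by (auto simp: numeral_eq_Suc)
  have cm: "continuous_on UNIV m" unfolding m_def[abs_def] by (intro continuous_intros)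
  have m0: "m x = 0" if "norm x \<ge> R" for x
  proof -
    have "R\<^sup>2 \<le> (norm x)\<^sup>2" using that R by (intro power_mono) auto
    then show ?thesis by (simp add: m_def)
  qed
  have m1: "m x = R\<^sup>2 - (norm x)\<^sup>2" if "norm x < R" for x
  proof -
    have "(norm x)\<^sup>2 \<le> R\<^sup>2" using that R by (intro power_mono) auto
    then show ?thesis by (simp add: m_def)
  qed
  have zero: "((\<lambda>x. (m x)\<^sup>2 * partial_deriv i (partial_deriv i f) x - 4 * m x * (partial_deriv i f x * x$i)) has_integral 0) UNIV" for i
  proof (rule integral_partial_eq_0[where g="\<lambda>x. (m x)\<^sup>2 * partial_deriv i f x" and e="axis i 1" and R=R])
    fix x
    have q: "((\<lambda>t. R\<^sup>2 - (norm (x + t *\<^sub>R axis i (1::real)))\<^sup>2) has_real_derivative - (2 * x$i)) (at 0)"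
    proof -
      have "(norm (x + t *\<^sub>R axis i (1::real)))\<^sup>2 = (norm x)\<^sup>2 + 2 * t * x$i + t\<^sup>2" for t
        unfolding power2_norm_eq_inner
        by (simp add: inner_add_left inner_add_right inner_axis inner_axis' algebra_simps) (simp add: power2_eq_square axis_def)
      then have "(\<lambda>t. R\<^sup>2 - (norm (x + t *\<^sub>R axis i (1::real)))\<^sup>2) = (\<lambda>t. R\<^sup>2 - ((norm x)\<^sup>2 + 2 * t * x$i + t\<^sup>2))"
        by simp
      moreover have "((\<lambda>t. R\<^sup>2 - ((norm x)\<^sup>2 + 2 * t * x$i + t\<^sup>2)) has_real_derivative - (2 * x$i)) (at 0)"
        by (auto intro!: derivative_eq_intros)
      ultimately show ?thesis by simp
    qed
    have "((\<lambda>t. (m (x + t *\<^sub>R axis i 1))\<^sup>2) has_real_derivative (2 * m x) * (- (2 * x$i))) (at 0)"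
      unfolding m_def using DERIV_chain2[OF max0_square_has_derivative q] by simp
    from DERIV_mult[OF this has_partials_has_derivative[of "partial_deriv i f" x i]]
    show "((\<lambda>t. (m (x + t *\<^sub>R axis i 1))\<^sup>2 * partial_deriv i f (x + t *\<^sub>R axis i 1)) has_real_derivative
       (m x)\<^sup>2 * partial_deriv i (partial_deriv i f) x - 4 * m x * (partial_deriv i f x * x$i)) (at 0)"
      using f1(1)[of i] by (simp add: algebra_simps)
  qed (use cf cm m0 in \<open>auto intro!: continuous_intros\<close>)
  have "((\<lambda>x. \<Sum>i\<in>UNIV. (m x)\<^sup>2 * partial_deriv i (partial_deriv i f) x - 4 * m x * (partial_deriv i f x * x$i)) has_integral (\<Sum>i\<in>(UNIV::'n set). 0)) UNIV"
    using zero by (intro has_integral_sum) auto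
  moreover have "(\<lambda>x. \<Sum>i\<in>UNIV. (m x)\<^sup>2 * partial_deriv i (partial_deriv i f) x - 4 * m x * (partial_deriv i f x * x$i))
    = (\<lambda>x. if x \<in> ball 0 R then (R\<^sup>2 - (norm x)\<^sup>2)\<^sup>2 * laplacian f x - 4 * (R\<^sup>2 - (norm x)\<^sup>2) * euler_deriv f x else 0)"
    by (auto simp: fun_eq_iff m0 m1 not_less sum_subtractf laplacian_def euler_deriv_def sum_distrib_left)
  ultimately have int0: "((\<lambda>x. (R\<^sup>2 - (norm x)\<^sup>2)\<^sup>2 * laplacian f x - 4 * (R\<^sup>2 - (norm x)\<^sup>2) * euler_deriv f x) has_integral 0) (ball 0 R)"
    by (simp only: has_integral_restrict_UNIV sum.neutral_const)
  have "continuous_on UNIV (laplacian f)" "continuous_on UNIV (euler_deriv f)"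
    using f Ck_laplacian[of 0 f] continuous_euler_deriv[OF Ck_antimono[of 1 2 f]] by (auto simp: numeral_2_eq_2 simp del: Ck.simps(2))
  then have int: "(\<lambda>x. (R\<^sup>2 - (norm x)\<^sup>2)\<^sup>2 * laplacian f x) integrable_on ball 0 R"
    "(\<lambda>x. 4 * (R\<^sup>2 - (norm x)\<^sup>2) * euler_deriv f x) integrable_on ball 0 R"
    by (auto intro!: integrable_on_ball_continuous continuous_intros)
  show ?thesis using integral_diff[OF int] integral_unique[OF int0] by simp
qed

lemma sph_avg_norm_power_mult:
  fixes f :: "real^'n \<Rightarrow> real"
  assumes "R > 0"
  shows "sph_avg (\<lambda>x. norm x ^ k * f x) R = R ^ k * sph_avg f R"
proof -
  have "integral (ball 0 1) (\<lambda>x. norm ((R / norm x) *\<^sub>R x) ^ k * f ((R / norm x) *\<^sub>R x))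
      = integral (ball 0 1) (\<lambda>x::real^'n. R ^ k * f ((R / norm x) *\<^sub>R x))"
    by (rule integral_spike[of "{0}"]) (use assms in auto)
  then show ?thesis by (simp add: sph_avg_def del: norm_scaleR)
qed

lemma has_derivative_ball_moment:
  fixes f :: "real^'n \<Rightarrow> real"
  assumes f: "continuous_on UNIV f" and R: "R > 0"
  shows "((\<lambda>r. integral (ball 0 r) (\<lambda>x. norm x ^ k * f x)) has_real_derivative
     real CARD('n) * measure lebesgue (ball (0::real^'n) 1) * R ^ (CARD('n) - 1) * (R ^ k * sph_avg f R)) (at R)"
  using has_derivative_ball_integral[of "\<lambda>x. norm x ^ k * f x" R] assms
  by (simp add: sph_avg_norm_power_mult continuous_intros del: sets_completion)

text \<open>The divergence theorem on balls is obtained by differentiating the weighted identity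
  twice in \<open>R\<close>: all boundary terms carry a factor that vanishes on the sphere of radius \<open>R\<close>.\<close>

lemma has_derivative_sph_avg_laplacian:
  fixes f :: "real^'n \<Rightarrow> real"
  assumes f: "Ck 2 f" and r: "r > 0"
  shows "(sph_avg f has_real_derivative integral (ball 0 r) (laplacian f) /
    (real CARD('n) * measure lebesgue (ball (0::real^'n) 1) * r ^ (CARD('n) - 1))) (at r)"
proof -
  let ?L = "laplacian f" and ?E = "euler_deriv f" and ?n = "CARD('n)"
  define c where "c = real ?n * measure lebesgue (ball (0::real^'n) 1)"
  have c: "c > 0" unfolding c_def using measure_ball_pos by simp
  have f1: "Ck 1 f" using Ck_antimono[of 1 2 f] f by simp
  have cL: "continuous_on UNIV ?L" using f Ck_laplacian[of 0 f] by (auto simp: numeral_2_eq_2 simp del: Ck.simps(2))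
  have cE: "continuous_on UNIV ?E" by (rule continuous_euler_deriv[OF f1])
  define J where "J k R = integral (ball 0 R) (\<lambda>x. norm x ^ k * ?L x)" for k R
  define W where "W k R = integral (ball 0 R) (\<lambda>x. norm x ^ k * ?E x)" for k R
  have dJ: "(J k has_real_derivative c * R ^ (?n - 1) * (R ^ k * sph_avg ?L R)) (at R)" if "R > 0" for k R
    unfolding J_def[abs_def] c_def by (rule has_derivative_ball_moment[OF cL that])
  have dW: "(W k has_real_derivative c * R ^ (?n - 1) * (R ^ k * sph_avg ?E R)) (at R)" if "R > 0" for k R
    unfolding W_def[abs_def] c_def by (rule has_derivative_ball_moment[OF cE that])
  have iL: "(\<lambda>x. norm x ^ k * ?L x) integrable_on ball 0 R" for k R
    by (intro integrable_on_ball_continuous continuous_intros cL)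
  have iE: "(\<lambda>x. norm x ^ k * ?E x) integrable_on ball 0 R" for k R
    by (intro integrable_on_ball_continuous continuous_intros cE)
  have eq0: "R ^ 4 * J 0 R - 2 * R\<^sup>2 * J 2 R + J 4 R = 4 * R\<^sup>2 * W 0 R - 4 * W 2 R" if "R > 0" for R
  proof -
    have e1: "(\<lambda>x. (R\<^sup>2 - (norm x)\<^sup>2)\<^sup>2 * ?L x) =
        (\<lambda>x. R ^ 4 * (norm x ^ 0 * ?L x) - 2 * R\<^sup>2 * (norm x ^ 2 * ?L x) + norm x ^ 4 * ?L x)"
      by (auto simp: fun_eq_iff power2_eq_square power4_eq_xxxx algebra_simps)
    have i1: "((\<lambda>x. R ^ 4 * (norm x ^ 0 * ?L x) - 2 * R\<^sup>2 * (norm x ^ 2 * ?L x) + norm x ^ 4 * ?L x) has_integral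
       R ^ 4 * J 0 R - 2 * R\<^sup>2 * J 2 R + J 4 R) (ball 0 R)"
      unfolding J_def using iL by (intro has_integral_add has_integral_diff has_integral_mult_right integrable_integral)
    have e2: "(\<lambda>x. 4 * (R\<^sup>2 - (norm x)\<^sup>2) * ?E x) = (\<lambda>x. 4 * R\<^sup>2 * (norm x ^ 0 * ?E x) - 4 * (norm x ^ 2 * ?E x))"
      by (auto simp: fun_eq_iff algebra_simps)
    have i2: "((\<lambda>x. 4 * R\<^sup>2 * (norm x ^ 0 * ?E x) - 4 * (norm x ^ 2 * ?E x)) has_integral
       4 * R\<^sup>2 * W 0 R - 4 * W 2 R) (ball 0 R)"
      unfolding W_def using iE by (intro has_integral_diff has_integral_mult_right integrable_integral)
    show ?thesis
      using weighted_green_identity[OF f that] unfolding e1 e2 integral_unique[OF i1] integral_unique[OF i2] .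
  qed
  have uniq: "x = y" if "(P has_real_derivative x) (at R)" "(Q has_real_derivative y) (at R)"
    "\<And>R. R > 0 \<Longrightarrow> P R = Q R" "R > 0" for P Q x y and R :: real
  proof -
    have "(Q has_real_derivative x) (at R)"
      by (rule has_field_derivative_transform_within_open[OF that(1), of "{0<..}"]) (use that in auto)
    then show ?thesis using that(2) DERIV_unique by blast
  qed
  have eq1: "R\<^sup>2 * J 0 R - J 2 R = 2 * W 0 R" if R: "R > 0" for R
  proof -
    have "((\<lambda>R. R ^ 4 * J 0 R - 2 * R\<^sup>2 * J 2 R + J 4 R) has_real_derivative 4 * R * (R\<^sup>2 * J 0 R - J 2 R)) (at R)"
      by (rule derivative_eq_intros dJ R refl)+
        (simp add: algebra_simps power2_eq_square power3_eq_cube power4_eq_xxxx)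
    moreover have "((\<lambda>R. 4 * R\<^sup>2 * W 0 R - 4 * W 2 R) has_real_derivative 4 * R * (2 * W 0 R)) (at R)"
      by (rule derivative_eq_intros dW R refl)+
        (simp add: algebra_simps power2_eq_square power3_eq_cube power4_eq_xxxx)
    ultimately have "4 * R * (R\<^sup>2 * J 0 R - J 2 R) = 4 * R * (2 * W 0 R)"
      by (rule uniq[OF _ _ eq0 R])
    then show ?thesis using R by simp
  qed
  have "((\<lambda>R. R\<^sup>2 * J 0 R - J 2 R) has_real_derivative 2 * r * J 0 r) (at r)"
    by (rule derivative_eq_intros dJ r refl)+
      (simp add: algebra_simps power2_eq_square power3_eq_cube power4_eq_xxxx)
  moreover have "((\<lambda>R. 2 * W 0 R) has_real_derivative 2 * (c * r ^ (?n - 1) * sph_avg ?E r)) (at r)"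
    by (rule derivative_eq_intros dW r refl)+ simp
  ultimately have "2 * r * J 0 r = 2 * (c * r ^ (?n - 1) * sph_avg ?E r)"
    by (rule uniq[OF _ _ eq1 r])
  then have "sph_avg ?E r / r = J 0 r / (c * r ^ (?n - 1))"
    using r c by (simp add: field_simps)
  moreover have "(sph_avg f has_real_derivative sph_avg ?E r / r) (at r)"
    by (rule has_derivative_sph_avg[OF Ck_continuous[OF f1] cE r]) (rule ray_has_derivative[OF f1])
  ultimately show ?thesis by (simp add: J_def c_def)
qed

section \<open>The radial system of differential equations\<close>

lemma eventually_power_lower_bound:
  fixes F F' :: "real \<Rightarrow> real"
  assumes a: "a > 0" and ev: "\<forall>\<^sub>F r in at_top. (F has_real_derivative F' r) (at r) \<and> a * r ^ k \<le> F' r"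
  shows "\<exists>a>0. \<forall>\<^sub>F r in at_top. a * r ^ Suc k \<le> F r"
proof -
  obtain N0 where N0: "\<And>r. r \<ge> N0 \<Longrightarrow> (F has_real_derivative F' r) (at r) \<and> a * r ^ k \<le> F' r"
    using ev by (auto simp: eventually_at_top_linorder)
  define N where "N = max N0 1"
  define b where "b = a / real (Suc k)"
  have b: "b > 0" using a by (simp add: b_def)
  define H where "H r = F r - b * r ^ Suc k" for r
  have dH: "(H has_real_derivative F' r - a * r ^ k) (at r)" if "r \<ge> N" for r
  proof -
    have "(H has_real_derivative F' r - b * (real (Suc k) * r ^ k)) (at r)"
      unfolding H_def[abs_def] using N0[of r] that DERIV_pow[of "Suc k" r UNIV]
      by (intro DERIV_diff DERIV_cmult) (auto simp: N_def)
    then show ?thesis by (simp add: b_def)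
  qed
  have mono: "H N \<le> H r" if "r \<ge> N" for r
  proof (rule DERIV_nonneg_imp_nondecreasing[OF that])
    fix x assume "N \<le> x"
    then show "\<exists>y. (H has_real_derivative y) (at x) \<and> 0 \<le> y" using dH[of x] N0[of x] by (auto simp: N_def)
  qed
  show ?thesis
  proof (intro exI[of _ "b/2"] conjI)
    show "\<forall>\<^sub>F r in at_top. b / 2 * r ^ Suc k \<le> F r"
      using eventually_ge_at_top[of N] eventually_ge_at_top[of "- H N * 2 / b"]
    proof eventually_elim
      case (elim r)
      have "r \<ge> 1" using elim by (simp add: N_def)
      then have "r \<le> r ^ Suc k" by (intro self_le_power) auto
      then have "- H N * 2 / b \<le> r ^ Suc k" using elim by linarith
      then have "- H N \<le> b / 2 * r ^ Suc k" using b by (simp add: field_simps)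
      with mono[OF elim(1)] show ?case by (simp add: H_def field_simps)
    qed
  qed (use b in simp)
qed

lemma radial_growth:
  fixes U V W :: "real \<Rightarrow> real"
  assumes c: "c > 0"
    and dV: "\<And>r. r > 0 \<Longrightarrow> (V has_real_derivative c * r ^ m * W r) (at r)"
    and dU: "\<And>r. r > 0 \<Longrightarrow> (U has_real_derivative V r / (c * r ^ m)) (at r)"
    and W: "\<exists>a>0. \<forall>\<^sub>F r in at_top. a * r ^ k \<le> W r"
    and l: "l = k + 2"
  shows "\<exists>a>0. \<forall>\<^sub>F r in at_top. a * r ^ l \<le> U r"
proof -
  obtain a where a: "a > 0" and ev: "\<forall>\<^sub>F r in at_top. a * r ^ k \<le> W r" using W by blast
  have "\<exists>b>0. \<forall>\<^sub>F r in at_top. b * r ^ Suc (m + k) \<le> V r"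
  proof (rule eventually_power_lower_bound[of "c * a"])
    show "\<forall>\<^sub>F r in at_top. (V has_real_derivative c * r ^ m * W r) (at r) \<and> c * a * r ^ (m + k) \<le> c * r ^ m * W r"
      using ev eventually_gt_at_top[of 0]
    proof eventually_elim
      case (elim r)
      have "c * r ^ m * (a * r ^ k) \<le> c * r ^ m * W r" using elim c by (intro mult_left_mono) auto
      then show ?case using dV[OF elim(2)] by (simp add: power_add mult_ac)
    qed
  qed (use a c in simp)
  then obtain b where b: "b > 0" and evV: "\<forall>\<^sub>F r in at_top. b * r ^ Suc (m + k) \<le> V r" by blast
  have "\<exists>b>0. \<forall>\<^sub>F r in at_top. b * r ^ Suc (Suc k) \<le> U r"
  proof (rule eventually_power_lower_bound[of "b / c"])
    show "\<forall>\<^sub>F r in at_top. (U has_real_derivative V r / (c * r ^ m)) (at r) \<and> b / c * r ^ Suc k \<le> V r / (c * r ^ m)"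
      using evV eventually_gt_at_top[of 0]
    proof eventually_elim
      case (elim r)
      have "b / c * r ^ Suc k = b * r ^ Suc (m + k) / (c * r ^ m)" using elim c by (simp add: power_add)
      also have "\<dots> \<le> V r / (c * r ^ m)" using elim c by (intro divide_right_mono) auto
      finally show ?case using dU[OF elim(2)] by simp
    qed
  qed (use b c in simp)
  then show ?thesis unfolding l by simp
qed

lemma nonneg_from_zero_limit:
  fixes H :: "real \<Rightarrow> real"
  assumes r: "r > 0" and lim: "(H \<longlongrightarrow> 0) (at_right 0)"
    and d: "\<And>s. 0 < s \<Longrightarrow> s \<le> r \<Longrightarrow> (H has_real_derivative H' s) (at s)"
    and nn: "\<And>s. 0 < s \<Longrightarrow> s \<le> r \<Longrightarrow> 0 \<le> H' s"
  shows "0 \<le> H r"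
proof (rule tendsto_upperbound[OF lim])
  have "\<forall>\<^sub>F s in at_right 0. s \<in> {0<..<r}" by (rule eventually_at_right_real[OF r])
  then show "\<forall>\<^sub>F s in at_right 0. H s \<le> H r"
  proof eventually_elim
    case (elim s)
    show ?case
    proof (rule DERIV_nonneg_imp_nondecreasing[where f=H])
      show "\<exists>y. (H has_real_derivative y) (at x) \<and> 0 \<le> y" if "s \<le> x" "x \<le> r" for x
        using that elim d[of x] nn[of x] by auto
    qed (use elim in auto)
  qed
qed simp

lemma radial_system_estimates:
  fixes U0 U1 U2 U3 V1 V2 V3 :: "real \<Rightarrow> real" and n :: nat and c q M :: real
  assumes n: "n \<ge> 1" and c: "c > 0" and q: "q > 0"
    and dV1: "\<And>r. r > 0 \<Longrightarrow> (V1 has_real_derivative c * r ^ (n - 1) * U1 r) (at r)"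
    and dV2: "\<And>r. r > 0 \<Longrightarrow> (V2 has_real_derivative c * r ^ (n - 1) * U2 r) (at r)"
    and dV3: "\<And>r. r > 0 \<Longrightarrow> (V3 has_real_derivative c * r ^ (n - 1) * U3 r) (at r)"
    and dU0: "\<And>r. r > 0 \<Longrightarrow> (U0 has_real_derivative V1 r / (c * r ^ (n - 1))) (at r)"
    and dU1: "\<And>r. r > 0 \<Longrightarrow> (U1 has_real_derivative V2 r / (c * r ^ (n - 1))) (at r)"
    and dU2: "\<And>r. r > 0 \<Longrightarrow> (U2 has_real_derivative V3 r / (c * r ^ (n - 1))) (at r)"
    and lim: "(V1 \<longlongrightarrow> 0) (at_right 0)" "(V2 \<longlongrightarrow> 0) (at_right 0)" "(V3 \<longlongrightarrow> 0) (at_right 0)"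
    and bound: "\<And>r. 0 < r \<Longrightarrow> r \<le> 1 \<Longrightarrow> U1 r \<le> M"
    and pos: "\<And>r. r > 0 \<Longrightarrow> U0 r > 0" "\<And>r. r > 0 \<Longrightarrow> V3 r > 0"
    and small: "\<And>e. e > 0 \<Longrightarrow> \<forall>\<^sub>F r in at_top. U0 r \<le> e * r ^ 4"
    and jensen: "\<And>r. r > 0 \<Longrightarrow> U0 r powr (- q) \<le> U3 r"
  shows "\<exists>C>0. \<forall>r>0. C * r powr (4 / q) \<le> U0 r"
    and "\<exists>C>0. \<forall>r>0. V3 r \<le> C * r powr (real n - 4)"
    and "q \<ge> 2" and "n \<ge> 4"
proof -
  have dV1': "((\<lambda>r. - V1 r) has_real_derivative c * r ^ (n - 1) * - U1 r) (at r)" if "r > 0" for r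
    using DERIV_minus[OF dV1[OF that]] by simp
  have dU0': "((\<lambda>r. - U0 r) has_real_derivative - V1 r / (c * r ^ (n - 1))) (at r)" if "r > 0" for r
    using DERIV_minus[OF dU0[OF that]] by simp
  have no_decay: False if "\<exists>a>0. \<forall>\<^sub>F r in at_top. a * r ^ k \<le> - U0 r" for k
  proof -
    obtain a where "a > 0" "\<forall>\<^sub>F r in at_top. a * r ^ k \<le> - U0 r" using \<open>\<exists>a>0. _ a\<close> by blast
    then have "\<forall>\<^sub>F r::real in at_top. False"
      using eventually_gt_at_top[of 0]
    proof (elim eventually_elim2)
      fix r :: real assume *: "a * r ^ k \<le> - U0 r" "0 < r"
      then have "0 \<le> a * r ^ k" using \<open>a > 0\<close> by simp
      then show False using * pos(1)[of r] by linarith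
    qed
    then show False by simp
  qed
  have U2_mono: "U2 r < U2 s" if "0 < r" "r < s" for r s
  proof (rule DERIV_pos_imp_increasing[OF that(2)])
    fix x assume "r \<le> x"
    then have x: "x > 0" using that by linarith
    then show "\<exists>y. (U2 has_real_derivative y) (at x) \<and> y > 0"
      using c pos(2)[OF x] by (intro exI[of _ "V3 x / (c * x ^ (n - 1))"] conjI dU2 divide_pos_pos) auto
  qed
  have U2_neg: "U2 r < 0" if r: "r > 0" for r
  proof (rule ccontr)
    assume "\<not> U2 r < 0"
    then have d: "U2 (r + 1) > 0" using U2_mono[of r "r+1"] r by simp
    have two: "2 = 0 + (2::nat)" "4 = 2 + (2::nat)" by simp_all
    have *: "\<exists>a>0. \<forall>\<^sub>F s in at_top. a * s ^ 0 \<le> U2 s"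
    proof (intro exI[of _ "U2 (r+1)"] conjI d)
      show "\<forall>\<^sub>F s in at_top. U2 (r+1) * s ^ 0 \<le> U2 s"
        using eventually_gt_at_top[of "r+1"]
        by eventually_elim (use r in \<open>auto intro!: less_imp_le U2_mono\<close>)
    qed
    have **: "\<exists>a>0. \<forall>\<^sub>F r in at_top. a * r ^ 2 \<le> U1 r"
      by (rule radial_growth[OF c dV2 dU1 * two(1)])
    have "\<exists>a>0. \<forall>\<^sub>F r in at_top. a * r ^ 4 \<le> U0 r"
      by (rule radial_growth[OF c dV1 dU0 ** two(2)])
    then obtain a where a: "a > 0" "\<forall>\<^sub>F r in at_top. a * r ^ 4 \<le> U0 r" by auto
    have "\<forall>\<^sub>F r::real in at_top. False"
      using a(2) small[of "a/2", OF half_gt_zero[OF a(1)]] eventually_gt_at_top[of 0]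
    proof eventually_elim
      case (elim r)
      then have "0 < a * r ^ 4" using a(1) by simp
      then show False using elim by simp
    qed
    then show False by simp
  qed
  have V2_le: "V2 r \<le> c * U2 R / real n * r ^ n" if "0 < r" "r \<le> R" for r R
  proof -
    have "0 \<le> c * U2 R / real n * r ^ n - V2 r"
    proof (rule nonneg_from_zero_limit[OF that(1)])
      show "((\<lambda>s. c * U2 R / real n * s ^ n - V2 s) \<longlongrightarrow> 0) (at_right 0)"
        using n by (auto intro!: tendsto_eq_intros lim)
      show "((\<lambda>s. c * U2 R / real n * s ^ n - V2 s) has_real_derivative c * s ^ (n - 1) * (U2 R - U2 s)) (at s)" if "0 < s" for s
        using n by (auto intro!: derivative_eq_intros dV2 that simp: field_simps)
      show "0 \<le> c * s ^ (n - 1) * (U2 R - U2 s)" if "0 < s" "s \<le> r" for s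
        using c that U2_mono[of s R] \<open>r \<le> R\<close> by (cases "s = R") auto
    qed
    then show ?thesis by simp
  qed
  have V2_neg: "V2 r < 0" if "r > 0" for r
  proof -
    have "c * U2 r / real n * r ^ n < 0"
      using c U2_neg[OF that] that n by (auto simp: mult_less_0_iff divide_less_0_iff mult_pos_neg)
    then show ?thesis using V2_le[of r r] that by simp
  qed
  have U1_mono: "U1 s < U1 r" if "0 < r" "r < s" for r s
  proof (rule DERIV_neg_imp_decreasing[OF that(2)])
    fix x assume "r \<le> x"
    then have x: "x > 0" using that by linarith
    then show "\<exists>y. (U1 has_real_derivative y) (at x) \<and> y < 0"
      using c V2_neg[OF x] by (intro exI[of _ "V2 x / (c * x ^ (n - 1))"] conjI dU1 divide_neg_pos) auto
  qed
  have U1_nonneg: "U1 r \<ge> 0" if r: "r > 0" for r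
  proof (rule ccontr)
    assume "\<not> U1 r \<ge> 0"
    then have d: "- U1 r > 0" by simp
    have *: "\<exists>a>0. \<forall>\<^sub>F s in at_top. a * s ^ 0 \<le> - U1 s"
    proof (intro exI[of _ "- U1 r"] conjI d)
      show "\<forall>\<^sub>F s in at_top. - U1 r * s ^ 0 \<le> - U1 s"
        using eventually_gt_at_top[of r]
        by eventually_elim (use r in \<open>auto intro!: less_imp_le U1_mono\<close>)
    qed
    show False
      by (rule no_decay, rule radial_growth[OF c dV1' dU0' * refl])
  qed
  have U1_le: "U1 r \<le> M" if "r > 0" for r
    using bound[of r] bound[of 1] U1_mono[of 1 r] that by (cases "r \<le> 1") auto
  have V1_nonneg: "V1 r \<ge> 0" if "r > 0" for r
    by (rule nonneg_from_zero_limit[OF that lim(1) dV1]) (use c U1_nonneg in auto)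
  have V1_le: "V1 r \<le> c * M / real n * r ^ n" if "0 < r" for r
  proof -
    have "0 \<le> c * M / real n * r ^ n - V1 r"
    proof (rule nonneg_from_zero_limit[OF that(1)])
      show "((\<lambda>s. c * M / real n * s ^ n - V1 s) \<longlongrightarrow> 0) (at_right 0)"
        using n by (auto intro!: tendsto_eq_intros lim)
      show "((\<lambda>s. c * M / real n * s ^ n - V1 s) has_real_derivative c * s ^ (n - 1) * (M - U1 s)) (at s)" if "0 < s" for s
        using n by (auto intro!: derivative_eq_intros dV1 that simp: field_simps)
      show "0 \<le> c * s ^ (n - 1) * (M - U1 s)" if "0 < s" "s \<le> r" for s
        using c that U1_le[of s] by auto
    qed
    then show ?thesis by simp
  qed
  have U0_mono: "U0 r \<le> U0 s" if "0 < r" "r \<le> s" for r s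
  proof (rule DERIV_nonneg_imp_nondecreasing[OF that(2)])
    fix x assume "r \<le> x"
    then have x: "x > 0" using that by linarith
    then show "\<exists>y. (U0 has_real_derivative y) (at x) \<and> 0 \<le> y"
      using c V1_nonneg[OF x] by (intro exI[of _ "V1 x / (c * x ^ (n - 1))"] conjI dU0 divide_nonneg_pos) auto
  qed
  have rn: "r ^ n = r ^ (n - 1) * r" for r :: real using n by (simp flip: power_Suc2)
  have U0_le: "U0 r \<le> U0 1 + M / (2 * real n) * r\<^sup>2" if "r \<ge> 1" for r
  proof -
    have "(M / (2 * real n) * 1\<^sup>2 - U0 1) \<le> (M / (2 * real n) * r\<^sup>2 - U0 r)"
    proof (rule DERIV_nonneg_imp_nondecreasing[OF that, where f="\<lambda>r. M / (2 * real n) * r\<^sup>2 - U0 r"])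
      fix s :: real assume s: "1 \<le> s"
      have "V1 s / (c * s ^ (n - 1)) \<le> (c * M / real n * s ^ n) / (c * s ^ (n - 1))"
        using s c V1_le[of s] by (intro divide_right_mono) auto
      also have "\<dots> = M / real n * s" using s c by (simp add: rn field_simps)
      finally have "0 \<le> M / real n * s - V1 s / (c * s ^ (n - 1))" by simp
      moreover have "((\<lambda>r. M / (2 * real n) * r\<^sup>2 - U0 r) has_real_derivative (M / real n * s - V1 s / (c * s ^ (n - 1)))) (at s)"
        using s n by (auto intro!: derivative_eq_intros dU0 simp: field_simps)
      ultimately show "\<exists>y. ((\<lambda>r. M / (2 * real n) * r\<^sup>2 - U0 r) has_real_derivative y) (at s) \<and> 0 \<le> y" by blast
    qed
    moreover have "0 \<le> M / (2 * real n) * 1\<^sup>2" using U1_nonneg[of 1] U1_le[of 1] by simp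
    ultimately show ?thesis by linarith
  qed
  have M: "M > 0" using U1_nonneg[of 2] U1_mono[of 1 2] U1_le[of 1] by simp
  have U2_ge: "- U2 R * R\<^sup>2 \<le> 8 * real n * M / 3" if R: "R > 0" for R
  proof -
    have "U2 R / (2 * real n) * (R/2)\<^sup>2 - U1 (R/2) \<le> U2 R / (2 * real n) * R\<^sup>2 - U1 R"
    proof (rule DERIV_nonneg_imp_nondecreasing[where f="\<lambda>r. U2 R / (2 * real n) * r\<^sup>2 - U1 r"])
      fix s :: real assume s: "R/2 \<le> s" "s \<le> R"
      then have s0: "s > 0" using R by linarith
      have "V2 s / (c * s ^ (n - 1)) \<le> (c * U2 R / real n * s ^ n) / (c * s ^ (n - 1))"
        using s s0 c V2_le[of s R] by (intro divide_right_mono) auto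
      also have "\<dots> = U2 R / real n * s" using s0 c by (simp add: rn field_simps)
      finally have "0 \<le> U2 R / real n * s - V2 s / (c * s ^ (n - 1))" by simp
      moreover have "((\<lambda>r. U2 R / (2 * real n) * r\<^sup>2 - U1 r) has_real_derivative (U2 R / real n * s - V2 s / (c * s ^ (n - 1)))) (at s)"
        using s0 n by (auto intro!: derivative_eq_intros dU1 simp: field_simps)
      ultimately show "\<exists>y. ((\<lambda>r. U2 R / (2 * real n) * r\<^sup>2 - U1 r) has_real_derivative y) (at s) \<and> 0 \<le> y" by blast
    qed (use R in simp)
    moreover have "U1 (R/2) \<le> M" "U1 R \<ge> 0" using U1_le U1_nonneg R by auto
    ultimately have "- (U2 R / (2 * real n) * R\<^sup>2) + U2 R / (2 * real n) * (R/2)\<^sup>2 \<le> M" by linarith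
    then show ?thesis using n by (simp add: field_simps power2_eq_square)
  qed
  have V3_mono: "V3 r \<le> V3 s" if "0 < r" "r \<le> s" for r s
  proof (rule DERIV_nonneg_imp_nondecreasing[OF that(2)])
    fix x assume "r \<le> x" "x \<le> s"
    then have "x > 0" using that by linarith
    moreover have "0 \<le> U3 x" using jensen[OF \<open>x > 0\<close>] order_trans powr_ge_zero by blast
    ultimately show "\<exists>y. (V3 has_real_derivative y) (at x) \<and> 0 \<le> y"
      using c by (intro exI[of _ "c * x ^ (n-1) * U3 x"] conjI dV3 mult_nonneg_nonneg) auto
  qed
  define C where "C = c * 2 ^ (n - 1) * (8 * real n * M / 3)"
  have C: "C > 0" unfolding C_def using c n M by auto
  have V3_le: "V3 r * r ^ 4 \<le> C * r ^ n" if r: "r > 0" for r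
  proof -
    define k where "k = V3 r / (c * (2 * r) ^ (n - 1))"
    have "U2 r - k * r \<le> U2 (2 * r) - k * (2 * r)"
    proof (rule DERIV_nonneg_imp_nondecreasing[where f="\<lambda>s. U2 s - k * s"])
      fix s assume s: "r \<le> s" "s \<le> 2 * r"
      have "k \<le> V3 s / (c * s ^ (n - 1))"
        unfolding k_def using s r c V3_mono[of r s] pos(2)[of s]
        by (intro frac_le mult_left_mono power_mono) auto
      moreover have "((\<lambda>s. U2 s - k * s) has_real_derivative (V3 s / (c * s ^ (n - 1)) - k)) (at s)"
        using s r by (auto intro!: derivative_eq_intros dU2)
      ultimately show "\<exists>y. ((\<lambda>s. U2 s - k * s) has_real_derivative y) (at s) \<and> 0 \<le> y" by force
    qed (use r in simp)
    then have "k * r \<le> - U2 r" using U2_neg[of "2 * r"] r by simp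
    then have "k * r * r\<^sup>2 \<le> - U2 r * r\<^sup>2" by (rule mult_right_mono) simp
    also have "\<dots> \<le> 8 * real n * M / 3" by (rule U2_ge[OF r])
    finally have k: "k * r * r\<^sup>2 \<le> 8 * real n * M / 3" .
    have "V3 r * r ^ 4 = c * 2 ^ (n - 1) * r ^ n * (k * r * r\<^sup>2)"
      using r c by (simp add: k_def rn power_mult_distrib power2_eq_square power4_eq_xxxx field_simps)
    also have "\<dots> \<le> c * 2 ^ (n - 1) * r ^ n * (8 * real n * M / 3)"
      using k r c by (intro mult_left_mono) auto
    finally show ?thesis by (simp add: C_def mult_ac)
  qed
  have V3_le': "V3 r \<le> C * r powr (real n - 4)" if r: "r > 0" for r
  proof -
    have "r powr (real n - 4) = r ^ n / r ^ 4" using r by (simp add: powr_diff powr_realpow flip: powr_numeral)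
    then show ?thesis using V3_le[OF r] r by (simp add: pos_le_divide_eq)
  qed
  then show "\<exists>C>0. \<forall>r>0. V3 r \<le> C * r powr (real n - 4)" using C by blast
  show n4: "n \<ge> 4"
  proof (rule ccontr)
    assume "\<not> n \<ge> 4"
    define r where "r = max 1 (2 * C / V3 1)"
    have r: "r \<ge> 1" "r \<ge> 2 * C / V3 1" by (auto simp: r_def)
    have "V3 1 * r ^ 4 \<le> V3 r * r ^ 4" using V3_mono[of 1 r] r by (intro mult_right_mono) auto
    also have "\<dots> \<le> C * r ^ n" using V3_le[of r] r by simp
    also have "\<dots> \<le> C * r ^ 3" using r C \<open>\<not> n \<ge> 4\<close> by (intro mult_left_mono power_increasing) auto
    finally have "(V3 1 * r) * r ^ 3 \<le> C * r ^ 3" by (simp add: numeral_eq_Suc mult_ac)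
    then have "V3 1 * r \<le> C" using r by simp
    moreover have "2 * C \<le> V3 1 * r" using r pos(2)[of 1] by (simp add: field_simps)
    ultimately show False using C by simp
  qed
  have V3_ge: "c / real n * r ^ n * U0 r powr (- q) \<le> V3 r" if r: "r > 0" for r
  proof -
    have "0 \<le> V3 r - c * U0 r powr (- q) / real n * r ^ n"
    proof (rule nonneg_from_zero_limit[OF r, where H="\<lambda>s. V3 s - c * U0 r powr (- q) / real n * s ^ n"])
      show "((\<lambda>s. V3 s - c * U0 r powr (- q) / real n * s ^ n) \<longlongrightarrow> 0) (at_right 0)"
        using n by (auto intro!: tendsto_eq_intros lim)
      show "((\<lambda>s. V3 s - c * U0 r powr (- q) / real n * s ^ n) has_real_derivative c * s ^ (n - 1) * (U3 s - U0 r powr (- q))) (at s)" if "0 < s" for s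
        using n by (auto intro!: derivative_eq_intros dV3 that simp: field_simps)
      show "0 \<le> c * s ^ (n - 1) * (U3 s - U0 r powr (- q))" if s: "0 < s" "s \<le> r" for s
      proof -
        have "U0 r powr (- q) \<le> U0 s powr (- q)"
          using U0_mono[OF s] pos(1)[OF s(1)] q by (intro powr_mono2') auto
        also have "\<dots> \<le> U3 s" by (rule jensen[OF s(1)])
        finally show ?thesis using c s by simp
      qed
    qed
    then show ?thesis by (simp add: mult_ac)
  qed
  define K where "K = (c / (real n * C)) powr (1 / q)"
  have K: "K > 0" using c n C by (simp add: K_def)
  have U0_ge: "K * r powr (4 / q) \<le> U0 r" if r: "r > 0" for r
  proof -
    have "c / real n * r ^ n * U0 r powr (- q) * r ^ 4 \<le> V3 r * r ^ 4"
      using V3_ge[OF r] r by (intro mult_right_mono) auto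
    also have "\<dots> \<le> C * r ^ n" by (rule V3_le[OF r])
    finally have "r ^ n * (c / real n * U0 r powr (- q) * r ^ 4) \<le> r ^ n * C" by (simp add: mult_ac)
    then have "c / real n * U0 r powr (- q) * r ^ 4 \<le> C" by (rule mult_left_le_imp_le) (use r in simp)
    then have "c / (real n * C) * r ^ 4 \<le> U0 r powr q"
      using C n pos(1)[OF r] by (simp add: powr_minus field_simps)
    then have "(c / (real n * C) * r ^ 4) powr (1 / q) \<le> (U0 r powr q) powr (1 / q)"
      using c C q r by (intro powr_mono2) auto
    also have "\<dots> = U0 r" using pos(1)[OF r] q by (simp add: powr_powr)
    also have "(c / (real n * C) * r ^ 4) powr (1 / q) = K * (r ^ 4) powr (1 / q)"
      unfolding K_def by (rule powr_mult)
    also have "(r ^ 4) powr (1 / q) = r powr (4 / q)"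
      using r by (simp add: powr_powr flip: powr_numeral)
    finally show ?thesis .
  qed
  then show "\<exists>C>0. \<forall>r>0. C * r powr (4 / q) \<le> U0 r" using K by blast
  show "q \<ge> 2"
  proof (rule ccontr)
    assume "\<not> q \<ge> 2"
    define p where "p = 4 / q - 2"
    have p: "p > 0" using \<open>\<not> q \<ge> 2\<close> q by (simp add: p_def field_simps)
    define A where "A = U0 1 + M / (2 * real n)"
    have A: "A > 0" using pos(1)[of 1] M n by (simp add: A_def add_pos_nonneg)
    have *: "K * r powr p \<le> A" if r: "r \<ge> 1" for r
    proof -
      have "K * r powr p * r\<^sup>2 = K * r powr (4 / q)"
        using r by (simp add: p_def powr_diff flip: powr_numeral)
      also have "\<dots> \<le> U0 r" using U0_ge r by simp
      also have "\<dots> \<le> U0 1 + M / (2 * real n) * r\<^sup>2" by (rule U0_le[OF r])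
      also have "\<dots> \<le> A * r\<^sup>2"
      proof -
        have "U0 1 * 1 \<le> U0 1 * r\<^sup>2" using pos(1)[of 1] r by (intro mult_left_mono) auto
        then show ?thesis by (simp add: A_def algebra_simps)
      qed
      finally show ?thesis using r by simp
    qed
    define r where "r = max 1 ((2 * A / K) powr (1 / p))"
    have "2 * A / K = ((2 * A / K) powr (1 / p)) powr p" using A K p by (simp add: powr_powr)
    also have "\<dots> \<le> r powr p" using p by (intro powr_mono2) (auto simp: r_def)
    finally have "2 * A \<le> K * r powr p" using K by (simp add: field_simps)
    then show False using *[of r] A by (simp add: r_def)
  qed
qed

section \<open>Estimates for the solution\<close>

lemma ball_integral_tendsto_0:
  fixes f :: "real^'n \<Rightarrow> real"
  assumes "continuous_on UNIV f"
  shows "((\<lambda>r. integral (ball 0 r) f) \<longlongrightarrow> 0) (at_right 0)"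
proof -
  obtain M where M: "M > 0" "\<And>x. norm x \<le> 1 \<Longrightarrow> \<bar>f x\<bar> \<le> M"
    using continuous_bounded_cball[OF assms] by blast
  let ?B = "measure lebesgue (ball (0::real^'n) 1)"
  show ?thesis
  proof (rule Lim_null_comparison)
    show "((\<lambda>r. M * (?B * r ^ CARD('n))) \<longlongrightarrow> 0) (at_right 0)"
      by (auto intro!: tendsto_eq_intros)
    have "\<forall>\<^sub>F r in at_right (0::real). r \<in> {0<..<1}" by (rule eventually_at_right_real) simp
    then show "\<forall>\<^sub>F r in at_right 0. norm (integral (ball 0 r) f) \<le> M * (?B * r ^ CARD('n))"
    proof eventually_elim
      case (elim r)
      then show ?case
        using annulus_integral_bound[of 0 r f M] integrable_on_ball_continuous[OF assms] M(2) by (simp add: zero_power)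
    qed
  qed
qed

lemma sph_avg_mono:
  fixes f g :: "real^'n \<Rightarrow> real"
  assumes f: "continuous_on UNIV f" and g: "continuous_on UNIV g" and r: "r \<ge> 0"
    and le: "\<And>x. norm x = r \<Longrightarrow> f x \<le> g x"
  shows "sph_avg f r \<le> sph_avg g r"
proof -
  define h where "h x = (if x = 0 then f 0 else g ((r / norm x) *\<^sub>R x))" for x :: "real^'n"
  have gi: "(\<lambda>x. g ((r / norm x) *\<^sub>R x)) integrable_on ball 0 1"
    using g r by (intro radial_integrable) auto
  have "h integrable_on ball 0 1"
    by (rule integrable_spike_finite[OF _ _ gi, of "{0}"]) (auto simp: h_def)
  then have "integral (ball 0 1) (\<lambda>x. f ((r / norm x) *\<^sub>R x)) \<le> integral (ball 0 1) h"
  proof (intro integral_le radial_integrable f r)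
    show "f ((r / norm x) *\<^sub>R x) \<le> h x" for x
      using r le[of "(r / norm x) *\<^sub>R x"] by (auto simp: h_def)
  qed simp_all
  also have "integral (ball 0 1) h = integral (ball 0 1) (\<lambda>x. g ((r / norm x) *\<^sub>R x))"
    by (rule integral_spike[of "{0}"]) (auto simp: h_def)
  finally show ?thesis
    unfolding sph_avg_def using measure_ball_pos[where 'n='n] by (intro divide_right_mono) auto
qed

lemma sph_avg_affine:
  fixes f :: "real^'n \<Rightarrow> real"
  assumes f: "continuous_on UNIV f" and r: "r \<ge> 0"
  shows "sph_avg (\<lambda>x. a + b * f x) r = a + b * sph_avg f r"
proof -
  have "((\<lambda>x. a * 1 + b * f ((r / norm x) *\<^sub>R x)) has_integral
     a * measure lebesgue (ball (0::real^'n) 1) + b * integral (ball 0 1) (\<lambda>x. f ((r / norm x) *\<^sub>R x))) (ball 0 1)"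
  proof (intro has_integral_add has_integral_mult_right integrable_integral radial_integrable f r)
    show "((\<lambda>x::real^'n. 1::real) has_integral measure lebesgue (ball (0::real^'n) 1)) (ball 0 1)"
      by (simp only: has_integral_iff lmeasure_integral[OF lmeasurable_ball] integrable_on_const[OF lmeasurable_ball])
  qed simp
  from integral_unique[OF this] show ?thesis
    using measure_ball_pos[where 'n='n] by (simp add: sph_avg_def add_divide_distrib)
qed

lemma sph_avg_const: "r \<ge> 0 \<Longrightarrow> sph_avg (\<lambda>x::real^'n. a) r = a"
  using sph_avg_affine[of "\<lambda>x::real^'n. 0" r a 0] by simp

lemma powr_neg_tangent:
  fixes a y q :: real
  assumes "a > 0" "y > 0" "q > 0"
  shows "a powr (- q) * (1 + q) + (- q * a powr (- q) / a) * y \<le> y powr (- q)"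
proof -
  define z where "z = y / a"
  have z: "z > 0" "y = a * z" using assms by (auto simp: z_def)
  have "1 + q - q * z \<le> 1 + (- q * ln z)"
    using mult_left_mono[OF ln_le_minus_one[OF z(1)], of q] assms by (simp add: algebra_simps)
  also have "\<dots> \<le> exp (- q * ln z)" by (rule exp_ge_add_one_self)
  also have "\<dots> = z powr (- q)" using z by (simp add: powr_def)
  finally have "a powr (- q) * (1 + q - q * z) \<le> a powr (- q) * z powr (- q)"
    by (intro mult_left_mono) auto
  also have "\<dots> = y powr (- q)" using z assms by (simp add: powr_mult)
  finally show ?thesis using z assms by (simp add: algebra_simps)
qed

lemma sph_avg_jensen_powr:
  fixes u :: "real^'n \<Rightarrow> real"
  assumes u: "continuous_on UNIV u" and pos: "\<And>x. u x > 0" and q: "q > 0" and r: "r \<ge> 0"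
    and a: "sph_avg u r > 0"
  shows "sph_avg u r powr (- q) \<le> sph_avg (\<lambda>x. u x powr (- q)) r"
proof -
  let ?a = "sph_avg u r"
  have cont: "continuous_on UNIV (\<lambda>x. u x powr (- q))"
    using pos by (intro continuous_intros u) (auto simp: less_imp_neq[THEN not_sym])
  have "sph_avg (\<lambda>x. ?a powr (- q) * (1 + q) + (- q * ?a powr (- q) / ?a) * u x) r
      \<le> sph_avg (\<lambda>x. u x powr (- q)) r"
    by (intro sph_avg_mono cont r powr_neg_tangent a pos q continuous_intros u)
  then show ?thesis unfolding sph_avg_affine[OF u r] using a by (simp add: algebra_simps)
qed

lemma positive_lower_bound_on_cball:
  fixes f :: "'a::euclidean_space \<Rightarrow> real"
  assumes "continuous_on UNIV f" "\<And>x. f x > 0" "r \<ge> 0"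
  obtains m where "m > 0" "\<And>x. norm x \<le> r \<Longrightarrow> m \<le> f x"
proof -
  have "\<exists>x\<in>cball 0 r. \<forall>y\<in>cball 0 r. f x \<le> f y"
    using assms by (intro continuous_attains_inf continuous_on_subset[OF assms(1)]) auto
  then show ?thesis using assms(2) that by force
qed

lemma positive_ball_integral:
  fixes f :: "real^'n \<Rightarrow> real"
  assumes f: "continuous_on UNIV f" and pos: "\<And>x. f x > 0" and r: "r > 0"
  shows "integral (ball 0 r) f > 0"
proof -
  obtain m where m: "m > 0" "\<And>y. norm y \<le> r \<Longrightarrow> m \<le> f y"
    using positive_lower_bound_on_cball[OF f pos, of r] r by auto
  have "integral (ball (0::real^'n) r) (\<lambda>x. m * 1) = m * measure lebesgue (ball (0::real^'n) r)"
    by (simp only: integral_mult_right lmeasure_integral[OF lmeasurable_ball])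
  then have "0 < integral (ball (0::real^'n) r) (\<lambda>x. m * 1)" using m r content_ball_pos[OF r, of "0::real^'n"] by simp
  also have "\<dots> \<le> integral (ball 0 r) f"
    by (rule integral_le[OF _ integrable_on_ball_continuous[OF f]]) (use m in \<open>auto intro: integrable_on_const\<close>)
  finally show ?thesis .
qed

lemma sph_avg_pos:
  fixes f :: "real^'n \<Rightarrow> real"
  assumes f: "continuous_on UNIV f" and pos: "\<And>x. f x > 0" and r: "r \<ge> 0"
  shows "sph_avg f r > 0"
proof -
  obtain m where m: "m > 0" "\<And>y. norm y \<le> r \<Longrightarrow> m \<le> f y"
    using positive_lower_bound_on_cball[OF f pos, of r] r by auto
  have "m = sph_avg (\<lambda>x::real^'n. m) r" using r by (simp add: sph_avg_const)
  also have "\<dots> \<le> sph_avg f r" using m r by (intro sph_avg_mono f continuous_intros) auto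
  finally show ?thesis using m(1) by simp
qed

lemma nonneg_integrable_of_bounded_ball_integrals:
  fixes g :: "real^'n \<Rightarrow> real"
  assumes g: "continuous_on UNIV g" and nn: "\<And>x. g x \<ge> 0"
    and bnd: "\<And>r. r > 0 \<Longrightarrow> integral (ball 0 r) g \<le> C"
  shows "g integrable_on UNIV"
proof -
  define f where "f k x = (if x \<in> ball 0 (real k) then g x else 0)" for k and x :: "real^'n"
  have int: "integral UNIV (f k) = integral (ball 0 (real k)) g" for k
    unfolding f_def[abs_def] by (rule Henstock_Kurzweil_Integration.integral_restrict_UNIV)
  have nn': "0 \<le> integral (ball 0 r) g" for r
    using nn by (intro integral_nonneg integrable_on_ball_continuous g)
  have "g integrable_on UNIV \<and> (\<lambda>k. integral UNIV (f k)) \<longlonglongrightarrow> integral UNIV g"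
  proof (rule monotone_convergence_increasing)
    show "f k integrable_on UNIV" for k
      unfolding f_def[abs_def] Henstock_Kurzweil_Integration.integrable_restrict_UNIV
      by (rule integrable_on_ball_continuous[OF g])
    show "f k x \<le> f (Suc k) x" for k x using nn[of x] by (auto simp: f_def)
    show "(\<lambda>k. f k x) \<longlonglongrightarrow> g x" for x
    proof (rule tendsto_eventually)
      obtain N where "norm x < real N" using reals_Archimedean2 by blast
      then show "\<forall>\<^sub>F k in sequentially. f k x = g x"
        by (intro eventually_sequentiallyI[of N]) (auto simp: f_def)
    qed
    have "norm (integral UNIV (f k)) \<le> \<bar>C\<bar>" for k
      using bnd[of "real k"] nn'[of "real k"] by (cases "k = 0") (auto simp: int)
    then show "bounded (range (\<lambda>k. integral UNIV (f k)))" unfolding bounded_iff by blast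
  qed
  then show ?thesis by blast
qed

theorem mainTheorem4:
  fixes u :: "real^'n \<Rightarrow> real" and q :: real
  assumes n2: "CARD('n) \<ge> 2"
    and q: "q > 0"
    and C6: "Ck 6 u"
    and pos: "\<forall>x. u x > 0"
    and eq: "\<forall>x. laplacian (laplacian (laplacian u)) x = u x powr (- q)"
    and growth: "u \<in> o[at_infinity](\<lambda>x. norm x ^ 4)"
  shows "(\<exists>C>0. \<forall>r\<ge>0. sph_avg u r \<ge> C * r powr (4 / q))
       \<and> (\<exists>C>0. \<forall>r>0. integral (ball 0 r) (\<lambda>x. u x powr (- q)) \<le> C * r powr (real CARD('n) - 4))
       \<and> (CARD('n) = 4 \<longrightarrow> (\<lambda>x. u x powr (- q)) integrable_on UNIV)
       \<and> q \<ge> 2 \<and> CARD('n) \<ge> 4"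
proof -
  let ?L1 = "laplacian u" and ?L2 = "laplacian (laplacian u)" and ?L3 = "\<lambda>x. u x powr (- q)"
  have L3: "laplacian ?L2 = ?L3" using eq by auto
  have C4: "Ck 4 ?L1" using Ck_laplacian[of 4 u] C6 by (simp add: numeral_eq_Suc del: Ck.simps)
  have C2: "Ck 2 ?L2" using Ck_laplacian[of 2 ?L1] C4 by (simp add: numeral_eq_Suc del: Ck.simps)
  have C0: "Ck 0 ?L3" unfolding L3[symmetric] using Ck_laplacian[of 0 ?L2] C2 by (simp add: numeral_eq_Suc del: Ck.simps)
  note cont = Ck_continuous[OF C6] Ck_continuous[OF C4] Ck_continuous[OF C2] Ck_continuous[OF C0]
  have C2': "Ck 2 u" "Ck 2 ?L1" using Ck_antimono[of 2 6 u] Ck_antimono[of 2 4 ?L1] C6 C4 by auto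
  have upos: "u x > 0" for x using pos by simp
  define c where "c = real CARD('n) * measure lebesgue (ball (0::real^'n) 1)"
  have c: "c > 0" unfolding c_def using measure_ball_pos by simp
  have dV: "((\<lambda>r. integral (ball 0 r) f) has_real_derivative c * r ^ (CARD('n) - 1) * sph_avg f r) (at r)"
    if "continuous_on UNIV f" "r > 0" for f :: "real^'n \<Rightarrow> real" and r
    unfolding c_def by (rule has_derivative_ball_integral[OF that])
  have dU: "(sph_avg f has_real_derivative integral (ball 0 r) (laplacian f) / (c * r ^ (CARD('n) - 1))) (at r)"
    if "Ck 2 f" "r > 0" for f :: "real^'n \<Rightarrow> real" and r
    unfolding c_def by (rule has_derivative_sph_avg_laplacian[OF that])
  obtain M where M: "M > 0" "\<And>x. norm x \<le> 1 \<Longrightarrow> \<bar>?L1 x\<bar> \<le> M"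
    using continuous_bounded_cball[OF cont(2)] by blast
  have bound: "sph_avg ?L1 r \<le> M" if "0 < r" "r \<le> 1" for r
  proof -
    have "sph_avg ?L1 r \<le> sph_avg (\<lambda>x::real^'n. M) r"
      by (rule sph_avg_mono) (use that M cont in \<open>auto simp: abs_le_iff\<close>)
    then show ?thesis using that by (simp add: sph_avg_const)
  qed
  have small: "\<forall>\<^sub>F r in at_top. sph_avg u r \<le> e * r ^ 4" if e: "e > 0" for e
  proof -
    have "\<forall>\<^sub>F x in at_infinity. norm (u x) \<le> e * norm (norm x ^ 4)"
      by (rule landau_o.smallD[OF growth e])
    then obtain b where b: "\<And>x. norm x \<ge> b \<Longrightarrow> u x \<le> e * norm x ^ 4"
      by (force simp: eventually_at_infinity)
    show ?thesis
      using eventually_ge_at_top[of "max 0 b"]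
    proof eventually_elim
      case (elim r)
      have "sph_avg u r \<le> sph_avg (\<lambda>x::real^'n. e * r ^ 4) r"
        by (rule sph_avg_mono) (use elim b cont in auto)
      then show ?case using elim by (simp add: sph_avg_const)
    qed
  qed
  have upos_avg: "sph_avg u r > 0" if "r \<ge> 0" for r by (rule sph_avg_pos[OF cont(1) upos that])
  have n1: "CARD('n) \<ge> 1" using n2 by simp
  have jensen: "sph_avg u r powr (- q) \<le> sph_avg ?L3 r" if "r > 0" for r
    using that by (intro sph_avg_jensen_powr cont upos q upos_avg) auto
  have V3pos: "integral (ball 0 r) ?L3 > 0" if "r > 0" for r
    using positive_ball_integral[OF cont(4) _ that] upos by (simp add: powr_gt_zero less_imp_neq[THEN not_sym])
  note est = radial_system_estimates[OF n1 c q dV[OF cont(2)] dV[OF cont(3)] dV[OF cont(4)]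
      dU[OF C2'(1)] dU[OF C2'(2)] dU[OF C2, unfolded L3]
      ball_integral_tendsto_0[OF cont(2)] ball_integral_tendsto_0[OF cont(3)] ball_integral_tendsto_0[OF cont(4)]
      bound upos_avg[OF less_imp_le] V3pos small jensen]
  obtain C1 where C1: "C1 > 0" "\<And>r. r > 0 \<Longrightarrow> C1 * r powr (4 / q) \<le> sph_avg u r"
    using est(1) by blast
  obtain C2 where C2: "C2 > 0" "\<And>r. r > 0 \<Longrightarrow> integral (ball 0 r) ?L3 \<le> C2 * r powr (real CARD('n) - 4)"
    using est(2) by blast
  have "C1 * r powr (4 / q) \<le> sph_avg u r" if "r \<ge> 0" for r
    using that C1(2)[of r] upos_avg[of 0] by (cases "r = 0") auto
  moreover have "?L3 integrable_on UNIV" if "CARD('n) = 4"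
    by (rule nonneg_integrable_of_bounded_ball_integrals[OF cont(4), of C2]) (use C2(2) that in auto)
  ultimately show ?thesis using C1(1) C2 est(3,4) by blast
qed

end
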